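(* Let $\alpha$ be a unital partial action of a group $G$ on a unital $K$-algebra $\mathcal A$ and let $n\in\mathbb N$ ($n\ge 1$). A cocycle $w\in Z^n_{par}(G,\mathcal A)$ is globalizable if and only if there exists a map $\widetilde w:G^n\to\mathcal A$ such that for all $g_1,\dots,g_{n+1}\in G$ $$\alpha_{g_1}\left(1_{g_1^{-1}}\widetilde w(g_2,\dots,g_{n+1})\right)+\sum_{i=1}^n(-1)^i1_{g_1}\widetilde w(g_1,\dots,g_ig_{i+1},\dots,g_{n+1})+(-1)^{n+1}1_{g_1}\widetilde w(g_1,\dots,g_n)=0$$ and $$w(g_1,\dots,g_n)=1_{(g_1,\dots,g_n)}\widetilde w(g_1,\dots,g_n)$$ for all $g_1,\dots,g_n\in G$.
   Context: $K$ is a commutative unital ring; algebras are associative $K$-algebras, not necessarily commutative. A partial action $\alpha$ of $G$ on an algebra $\mathcal A$ is a family of two-sided ideals $\mathcal D_g$ and algebra isomorphisms $\alpha_g:\mathcal D_{g^{-1}}\to\mathcal D_g$ ($g\in G$) such that $\alpha_1=\mathrm{id}_{\mathcal A}$, and whenever $a\in\mathcal D_{h^{-1}}$ and $\alpha_h(a)\in\mathcal D_{g^{-1}}$, then $a\in\mathcal D_{(gh)^{-1}}$ and $\alpha_g(\alpha_h(a))=\alpha_{gh}(a)$. It is unital if $\mathcal D_g=1_g\mathcal A$ for a central idempotent $1_g$ of $\mathcal A$. Put $1_{(g_1,\dots,g_n)}=1_{g_1}1_{g_1g_2}\cdots1_{g_1\cdots g_n}$. For $n\ge1$ let $C^n_{par}(G,\mathcal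 A)=\{f:G^n\to\mathcal A\mid f(g_1,\dots,g_n)\in1_{(g_1,\dots,g_n)}\mathcal A\}$ and $$(\delta^nf)(g_1,\dots,g_{n+1})=\alpha_{g_1}(1_{g_1^{-1}}f(g_2,\dots,g_{n+1}))+\sum_{i=1}^n(-1)^i1_{g_1\cdots g_i}f(g_1,\dots,g_ig_{i+1},\dots,g_{n+1})+(-1)^{n+1}1_{g_1\cdots g_{n+1}}f(g_1,\dots,g_n).$$ $Z^n_{par}(G,\mathcal A)=\ker(\delta^n:C^n_{par}(G,\mathcal A)\to C^{n+1}_{par}(G,\mathcal A))$. An enveloping action of $(\mathcal A,\alpha)$ is a (global) action $\beta$ of $G$ by automorphisms on an algebra $\mathcal B$ (possibly without $1$) with an injective algebra homomorphism $\varphi:\mathcal A\to\mathcal B$ such that $\varphi(\mathcal A)$ is a two-sided ideal of $\mathcal B$, $\mathcal B=\sum_{g\in G}\beta_g(\varphi(\mathcal A))$, $\varphi(\mathcal D_g)=\varphi(\mathcal A)\cap\beta_g(\varphi(\mathcal A))$, and $\varphi\circ\alpha_g=\beta_g\circ\varphi$ on $\mathcal D_{g^{-1}}$. For a unital partial action an enveloping action exists and is unique up to isomorphism; fix one. The multiplier algebra is $\mathcal M(\mathcal B)=\{(R,L)\in\mathrm{End}({}_{\mathcal B}\mathcal B)\times\mathrm{End}(\mathcal B_{\mathcal B}) : (aR)b=a(Lb)\ \forall a,b\in\mathcal B\}$ (left module maps written on the right); for $\gamma=(R,L)$ write $b\gamma=bR$, $\gamma b=Lb$. $G$ acts on it by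 $\beta^*_g(u)=\beta_gu\beta_g^{-1}$. $Z^n(G,\mathcal M(\mathcal B))$ is the group of classical $n$-cocycles of $G$ with values in the additive group of $\mathcal M(\mathcal B)$ with this action. A cocycle $w\in Z^n_{par}(G,\mathcal A)$ is globalizable if there is $u\in Z^n(G,\mathcal M(\mathcal B))$ with $\varphi(w(g_1,\dots,g_n))=\varphi(1_{(g_1,\dots,g_n)})u(g_1,\dots,g_n)$ for all $g_1,\dots,g_n\in G$. *)

theory Defs
  imports "HOL-Algebra.Module"
begin

section \<open>Associative algebras\<close>

text \<open>Associative, not necessarily commutative algebras over a commutative unital ring, possibly
  without identity: the field \<open>one\<close> of the record \<open>A\<close> is not mentioned.
  (The locale \<open>algebra\<close> of \<open>HOL-Algebra.Module\<close> is restricted to commutative unital algebras.)\<close>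

locale assoc_algebra = module K A for K (structure) and A (structure) +
  assumes mult_closed: "\<lbrakk>x \<in> carrier A; y \<in> carrier A\<rbrakk> \<Longrightarrow> x \<otimes>\<^bsub>A\<^esub> y \<in> carrier A"
    and mult_assoc: "\<lbrakk>x \<in> carrier A; y \<in> carrier A; z \<in> carrier A\<rbrakk>
      \<Longrightarrow> (x \<otimes>\<^bsub>A\<^esub> y) \<otimes>\<^bsub>A\<^esub> z = x \<otimes>\<^bsub>A\<^esub> (y \<otimes>\<^bsub>A\<^esub> z)"
    and mult_l_distr: "\<lbrakk>x \<in> carrier A; y \<in> carrier A; z \<in> carrier A\<rbrakk>
      \<Longrightarrow> (x \<oplus>\<^bsub>A\<^esub> y) \<otimes>\<^bsub>A\<^esub> z = x \<otimes>\<^bsub>A\<^esub> z \<oplus>\<^bsub>A\<^esub> y \<otimes>\<^bsub>A\<^esub> z"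
    and mult_r_distr: "\<lbrakk>x \<in> carrier A; y \<in> carrier A; z \<in> carrier A\<rbrakk>
      \<Longrightarrow> z \<otimes>\<^bsub>A\<^esub> (x \<oplus>\<^bsub>A\<^esub> y) = z \<otimes>\<^bsub>A\<^esub> x \<oplus>\<^bsub>A\<^esub> z \<otimes>\<^bsub>A\<^esub> y"
    and smult_mult_left: "\<lbrakk>k \<in> carrier K; x \<in> carrier A; y \<in> carrier A\<rbrakk>
      \<Longrightarrow> (k \<odot>\<^bsub>A\<^esub> x) \<otimes>\<^bsub>A\<^esub> y = k \<odot>\<^bsub>A\<^esub> (x \<otimes>\<^bsub>A\<^esub> y)"
    and smult_mult_right: "\<lbrakk>k \<in> carrier K; x \<in> carrier A; y \<in> carrier A\<rbrakk>
      \<Longrightarrow> x \<otimes>\<^bsub>A\<^esub> (k \<odot>\<^bsub>A\<^esub> y) = k \<odot>\<^bsub>A\<^esub> (x \<otimes>\<^bsub>A\<^esub> y)"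

locale unital_assoc_algebra = assoc_algebra K A + ring A for K (structure) and A (structure)

text \<open>The library's \<open>ideal\<close> presupposes an identity element.\<close>

locale algebra_ideal = submodule I K A for I and K (structure) and A (structure) +
  assumes ideal_l_closed: "\<lbrakk>x \<in> I; a \<in> carrier A\<rbrakk> \<Longrightarrow> a \<otimes>\<^bsub>A\<^esub> x \<in> I"
    and ideal_r_closed: "\<lbrakk>x \<in> I; a \<in> carrier A\<rbrakk> \<Longrightarrow> x \<otimes>\<^bsub>A\<^esub> a \<in> I"

text \<open>Algebra homomorphisms; identity elements need not be preserved.\<close>

definition algebra_hom ::
  "('k, 'r) ring_scheme \<Rightarrow> ('k, 'a, 's) module_scheme \<Rightarrow> ('k, 'b, 't) module_scheme \<Rightarrow> ('a \<Rightarrow> 'b) set"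
  where "algebra_hom K A B = {f. f \<in> hom (add_monoid A) (add_monoid B) \<and> f \<in> hom A B
    \<and> (\<forall>k\<in>carrier K. \<forall>x\<in>carrier A. f (k \<odot>\<^bsub>A\<^esub> x) = k \<odot>\<^bsub>B\<^esub> f x)}"

definition algebra_iso ::
  "('k, 'r) ring_scheme \<Rightarrow> ('k, 'a, 's) module_scheme \<Rightarrow> ('k, 'b, 't) module_scheme \<Rightarrow> ('a \<Rightarrow> 'b) set"
  where "algebra_iso K A B = {f \<in> algebra_hom K A B. bij_betw f (carrier A) (carrier B)}"


section \<open>Partial actions and enveloping actions\<close>

locale partial_action = assoc_algebra K A + G: group G
  for K (structure) and A (structure) and G (structure) +
  fixes D :: "'g \<Rightarrow> 'a set" and \<alpha> :: "'g \<Rightarrow> 'a \<Rightarrow> 'a"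
  assumes D_ideal: "g \<in> carrier G \<Longrightarrow> algebra_ideal (D g) K A"
    and \<alpha>_iso: "g \<in> carrier G \<Longrightarrow>
      \<alpha> g \<in> algebra_iso K (A\<lparr>carrier := D (inv\<^bsub>G\<^esub> g)\<rparr>) (A\<lparr>carrier := D g\<rparr>)"
    and D_one: "D \<one>\<^bsub>G\<^esub> = carrier A"
    and \<alpha>_one: "a \<in> carrier A \<Longrightarrow> \<alpha> \<one>\<^bsub>G\<^esub> a = a"
    and D_comp: "\<lbrakk>g \<in> carrier G; h \<in> carrier G; a \<in> D (inv\<^bsub>G\<^esub> h); \<alpha> h a \<in> D (inv\<^bsub>G\<^esub> g)\<rbrakk>
      \<Longrightarrow> a \<in> D (inv\<^bsub>G\<^esub> (g \<otimes>\<^bsub>G\<^esub> h))"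
    and \<alpha>_comp: "\<lbrakk>g \<in> carrier G; h \<in> carrier G; a \<in> D (inv\<^bsub>G\<^esub> h); \<alpha> h a \<in> D (inv\<^bsub>G\<^esub> g)\<rbrakk>
      \<Longrightarrow> \<alpha> g (\<alpha> h a) = \<alpha> (g \<otimes>\<^bsub>G\<^esub> h) a"

text \<open>\<open>e g\<close> is the central idempotent \<open>1\<^sub>g\<close>; it is determined by \<open>D g\<close>, being the identity
  of that ideal.\<close>

locale unital_partial_action = partial_action K A G D \<alpha> + unital_assoc_algebra K A
  for K (structure) and A (structure) and G (structure)
    and D :: "'g \<Rightarrow> 'a set" and \<alpha> :: "'g \<Rightarrow> 'a \<Rightarrow> 'a" +
  fixes e :: "'g \<Rightarrow> 'a"
  assumes e_closed: "g \<in> carrier G \<Longrightarrow> e g \<in> carrier A"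
    and e_idem: "g \<in> carrier G \<Longrightarrow> e g \<otimes>\<^bsub>A\<^esub> e g = e g"
    and e_central: "\<lbrakk>g \<in> carrier G; a \<in> carrier A\<rbrakk> \<Longrightarrow> e g \<otimes>\<^bsub>A\<^esub> a = a \<otimes>\<^bsub>A\<^esub> e g"
    and D_eq: "g \<in> carrier G \<Longrightarrow> D g = {e g \<otimes>\<^bsub>A\<^esub> a | a. a \<in> carrier A}"

locale global_action = assoc_algebra K B + G: group G
  for K (structure) and B (structure) and G (structure) +
  fixes \<beta> :: "'g \<Rightarrow> 'b \<Rightarrow> 'b"
  assumes \<beta>_auto: "g \<in> carrier G \<Longrightarrow> \<beta> g \<in> algebra_iso K B B"
    and \<beta>_one: "b \<in> carrier B \<Longrightarrow> \<beta> \<one>\<^bsub>G\<^esub> b = b"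
    and \<beta>_comp: "\<lbrakk>g \<in> carrier G; h \<in> carrier G; b \<in> carrier B\<rbrakk>
      \<Longrightarrow> \<beta> g (\<beta> h b) = \<beta> (g \<otimes>\<^bsub>G\<^esub> h) b"

locale enveloping_action = partial_action K A G D \<alpha> + glob: global_action K B G \<beta>
  for K (structure) and A (structure) and G (structure)
    and D :: "'g \<Rightarrow> 'a set" and \<alpha> :: "'g \<Rightarrow> 'a \<Rightarrow> 'a"
    and B (structure) and \<beta> :: "'g \<Rightarrow> 'b \<Rightarrow> 'b" +
  fixes \<phi> :: "'a \<Rightarrow> 'b"
  assumes \<phi>_hom: "\<phi> \<in> algebra_hom K A B"
    and \<phi>_inj: "inj_on \<phi> (carrier A)"
    and \<phi>_ideal: "algebra_ideal (\<phi> ` carrier A) K B"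
    and \<phi>_span: "carrier B = {(\<Oplus>\<^bsub>B\<^esub>g\<in>F. x g) | F x.
      finite F \<and> F \<subseteq> carrier G \<and> (\<forall>g\<in>F. x g \<in> \<beta> g ` \<phi> ` carrier A)}"
    and \<phi>_D: "g \<in> carrier G \<Longrightarrow> \<phi> ` D g = \<phi> ` carrier A \<inter> \<beta> g ` \<phi> ` carrier A"
    and \<phi>_equivariant: "\<lbrakk>g \<in> carrier G; a \<in> D (inv\<^bsub>G\<^esub> g)\<rbrakk> \<Longrightarrow> \<phi> (\<alpha> g a) = \<beta> g (\<phi> a)"


section \<open>Cochains on tuples of group elements\<close>

text \<open>The elements of \<open>G\<^sup>n\<close> are lists of length \<open>n\<close>. A cochain is a function on lists of which
  only the values on \<open>G\<^sup>n\<close> matter.\<close>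

definition tuples :: "('g, 'm) monoid_scheme \<Rightarrow> nat \<Rightarrow> 'g list set"
  where "tuples G n = {gs. length gs = n \<and> set gs \<subseteq> carrier G}"

definition list_mult :: "('g, 'm) monoid_scheme \<Rightarrow> 'g list \<Rightarrow> 'g"
  where "list_mult G gs = foldr (\<otimes>\<^bsub>G\<^esub>) gs \<one>\<^bsub>G\<^esub>"

text \<open>For \<open>1 \<le> i \<le> n\<close> the tuple \<open>(g\<^sub>1, \<dots>, g\<^sub>i g\<^sub>i\<^sub>+\<^sub>1, \<dots>, g\<^sub>n\<^sub>+\<^sub>1)\<close>; list positions start at \<open>0\<close>.\<close>

definition merge :: "('g, 'm) monoid_scheme \<Rightarrow> nat \<Rightarrow> 'g list \<Rightarrow> 'g list"
  where "merge G i gs = take (i - 1) gs @ [gs ! (i - 1) \<otimes>\<^bsub>G\<^esub> gs ! i] @ drop (i + 1) gs"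

text \<open>The classical group \<open>Z\<^sup>n(G, M)\<close> of cocycles with values in the additive group of \<open>M\<close>, on which
  \<open>G\<close> acts by \<open>act\<close>.\<close>

definition coboundary ::
  "('g, 'm) monoid_scheme \<Rightarrow> ('c, 's) ring_scheme \<Rightarrow> ('g \<Rightarrow> 'c \<Rightarrow> 'c) \<Rightarrow> nat
    \<Rightarrow> ('g list \<Rightarrow> 'c) \<Rightarrow> 'g list \<Rightarrow> 'c"
  where "coboundary G M act n f gs =
    act (hd gs) (f (tl gs))
    \<oplus>\<^bsub>M\<^esub> (\<Oplus>\<^bsub>M\<^esub>i\<in>{1..n}. [((-1::int) ^ i)] \<cdot>\<^bsub>M\<^esub> f (merge G i gs))
    \<oplus>\<^bsub>M\<^esub> [((-1::int) ^ (n + 1))] \<cdot>\<^bsub>M\<^esub> f (butlast gs)"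

definition cocycles ::
  "('g, 'm) monoid_scheme \<Rightarrow> ('c, 's) ring_scheme \<Rightarrow> ('g \<Rightarrow> 'c \<Rightarrow> 'c) \<Rightarrow> nat \<Rightarrow> ('g list \<Rightarrow> 'c) set"
  where "cocycles G M act n = {u \<in> tuples G n \<rightarrow> carrier M.
    \<forall>gs\<in>tuples G (n + 1). coboundary G M act n u gs = \<zero>\<^bsub>M\<^esub>}"

text \<open>\<open>1\<^sub>(\<^sub>g\<^sub>1\<^sub>,\<^sub>\<dots>\<^sub>,\<^sub>g\<^sub>n\<^sub>)\<close>, the product of the idempotents \<open>e (g\<^sub>1 \<cdots> g\<^sub>i)\<close> for \<open>i = 1, \<dots>, n\<close>.\<close>

definition tuple_unit ::
  "('a, 's) ring_scheme \<Rightarrow> ('g, 'm) monoid_scheme \<Rightarrow> ('g \<Rightarrow> 'a) \<Rightarrow> 'g list \<Rightarrow> 'a"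
  where "tuple_unit A G e gs =
    list_mult A (map (\<lambda>i. e (list_mult G (take i gs))) [1..<length gs + 1])"

definition par_cochains ::
  "('a, 's) ring_scheme \<Rightarrow> ('g, 'm) monoid_scheme \<Rightarrow> ('g \<Rightarrow> 'a) \<Rightarrow> nat \<Rightarrow> ('g list \<Rightarrow> 'a) set"
  where "par_cochains A G e n =
    {f. \<forall>gs\<in>tuples G n. f gs \<in> {tuple_unit A G e gs \<otimes>\<^bsub>A\<^esub> a | a. a \<in> carrier A}}"

definition par_coboundary ::
  "('a, 's) ring_scheme \<Rightarrow> ('g, 'm) monoid_scheme \<Rightarrow> ('g \<Rightarrow> 'a \<Rightarrow> 'a) \<Rightarrow> ('g \<Rightarrow> 'a) \<Rightarrow> nat
    \<Rightarrow> ('g list \<Rightarrow> 'a) \<Rightarrow> 'g list \<Rightarrow> 'a"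
  where "par_coboundary A G \<alpha> e n f gs =
    \<alpha> (hd gs) (e (inv\<^bsub>G\<^esub> (hd gs)) \<otimes>\<^bsub>A\<^esub> f (tl gs))
    \<oplus>\<^bsub>A\<^esub> (\<Oplus>\<^bsub>A\<^esub>i\<in>{1..n}. [((-1::int) ^ i)] \<cdot>\<^bsub>A\<^esub> (e (list_mult G (take i gs)) \<otimes>\<^bsub>A\<^esub> f (merge G i gs)))
    \<oplus>\<^bsub>A\<^esub> [((-1::int) ^ (n + 1))] \<cdot>\<^bsub>A\<^esub> (e (list_mult G gs) \<otimes>\<^bsub>A\<^esub> f (butlast gs))"

definition par_cocycles ::
  "('a, 's) ring_scheme \<Rightarrow> ('g, 'm) monoid_scheme \<Rightarrow> ('g \<Rightarrow> 'a \<Rightarrow> 'a) \<Rightarrow> ('g \<Rightarrow> 'a) \<Rightarrow> nat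
    \<Rightarrow> ('g list \<Rightarrow> 'a) set"
  where "par_cocycles A G \<alpha> e n = {f \<in> par_cochains A G e n.
    \<forall>gs\<in>tuples G (n + 1). par_coboundary A G \<alpha> e n f gs = \<zero>\<^bsub>A\<^esub>}"


section \<open>The multiplier algebra and globalizable cocycles\<close>

text \<open>The functions are extensional, so that equality in the multiplier algebra is equality of the
  maps on \<open>carrier B\<close>.\<close>

definition left_module_endos ::
  "('k, 'r) ring_scheme \<Rightarrow> ('k, 'b, 't) module_scheme \<Rightarrow> ('b \<Rightarrow> 'b) set"
  where "left_module_endos K B = {R \<in> carrier B \<rightarrow>\<^sub>E carrier B.
    (\<forall>a\<in>carrier B. \<forall>b\<in>carrier B. R (a \<oplus>\<^bsub>B\<^esub> b) = R a \<oplus>\<^bsub>B\<^esub> R b)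
    \<and> (\<forall>k\<in>carrier K. \<forall>b\<in>carrier B. R (k \<odot>\<^bsub>B\<^esub> b) = k \<odot>\<^bsub>B\<^esub> R b)
    \<and> (\<forall>a\<in>carrier B. \<forall>b\<in>carrier B. R (a \<otimes>\<^bsub>B\<^esub> b) = a \<otimes>\<^bsub>B\<^esub> R b)}"

definition right_module_endos ::
  "('k, 'r) ring_scheme \<Rightarrow> ('k, 'b, 't) module_scheme \<Rightarrow> ('b \<Rightarrow> 'b) set"
  where "right_module_endos K B = {L \<in> carrier B \<rightarrow>\<^sub>E carrier B.
    (\<forall>a\<in>carrier B. \<forall>b\<in>carrier B. L (a \<oplus>\<^bsub>B\<^esub> b) = L a \<oplus>\<^bsub>B\<^esub> L b)
    \<and> (\<forall>k\<in>carrier K. \<forall>b\<in>carrier B. L (k \<odot>\<^bsub>B\<^esub> b) = k \<odot>\<^bsub>B\<^esub> L b)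
    \<and> (\<forall>a\<in>carrier B. \<forall>b\<in>carrier B. L (a \<otimes>\<^bsub>B\<^esub> b) = L a \<otimes>\<^bsub>B\<^esub> b)}"

text \<open>\<open>R\<close> is written on the right of its argument, so the first component of the product
  \<open>(R, L) (R', L')\<close> is \<open>b \<mapsto> (b R) R'\<close>.\<close>

definition multiplier_algebra ::
  "('k, 'r) ring_scheme \<Rightarrow> ('k, 'b, 't) module_scheme \<Rightarrow> ('k, ('b \<Rightarrow> 'b) \<times> ('b \<Rightarrow> 'b)) module"
  where "multiplier_algebra K B = \<lparr>
    carrier = {(R, L). R \<in> left_module_endos K B \<and> L \<in> right_module_endos K B
      \<and> (\<forall>a\<in>carrier B. \<forall>b\<in>carrier B. R a \<otimes>\<^bsub>B\<^esub> b = a \<otimes>\<^bsub>B\<^esub> L b)},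
    mult = \<lambda>(R, L) (R', L'). (compose (carrier B) R' R, compose (carrier B) L L'),
    one = (\<lambda>b\<in>carrier B. b, \<lambda>b\<in>carrier B. b),
    zero = (\<lambda>b\<in>carrier B. \<zero>\<^bsub>B\<^esub>, \<lambda>b\<in>carrier B. \<zero>\<^bsub>B\<^esub>),
    add = \<lambda>(R, L) (R', L'). (\<lambda>b\<in>carrier B. R b \<oplus>\<^bsub>B\<^esub> R' b, \<lambda>b\<in>carrier B. L b \<oplus>\<^bsub>B\<^esub> L' b),
    smult = \<lambda>k (R, L). (\<lambda>b\<in>carrier B. k \<odot>\<^bsub>B\<^esub> R b, \<lambda>b\<in>carrier B. k \<odot>\<^bsub>B\<^esub> L b)\<rparr>"

text \<open>The induced action \<open>\<beta>\<^sup>*\<^sub>g(u) = \<beta>\<^sub>g u \<beta>\<^sub>g\<^sup>-\<^sup>1\<close> on both components, where \<open>\<beta>\<^sub>g\<^sup>-\<^sup>1\<close> is \<open>\<beta> (inv g)\<close>.\<close>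

definition multiplier_action ::
  "('g, 'm) monoid_scheme \<Rightarrow> ('k, 'b, 't) module_scheme \<Rightarrow> ('g \<Rightarrow> 'b \<Rightarrow> 'b)
    \<Rightarrow> 'g \<Rightarrow> ('b \<Rightarrow> 'b) \<times> ('b \<Rightarrow> 'b) \<Rightarrow> ('b \<Rightarrow> 'b) \<times> ('b \<Rightarrow> 'b)"
  where "multiplier_action G B \<beta> g = (\<lambda>(R, L).
    (\<lambda>b\<in>carrier B. \<beta> g (R (\<beta> (inv\<^bsub>G\<^esub> g) b)), \<lambda>b\<in>carrier B. \<beta> g (L (\<beta> (inv\<^bsub>G\<^esub> g) b))))"

definition mult_right :: "'b \<Rightarrow> ('b \<Rightarrow> 'b) \<times> ('b \<Rightarrow> 'b) \<Rightarrow> 'b"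
  where "mult_right b \<gamma> = fst \<gamma> b"

definition globalizable ::
  "('k, 'r) ring_scheme \<Rightarrow> ('k, 'a, 's) module_scheme \<Rightarrow> ('g, 'm) monoid_scheme \<Rightarrow> ('g \<Rightarrow> 'a)
    \<Rightarrow> ('k, 'b, 't) module_scheme \<Rightarrow> ('g \<Rightarrow> 'b \<Rightarrow> 'b) \<Rightarrow> ('a \<Rightarrow> 'b) \<Rightarrow> nat \<Rightarrow> ('g list \<Rightarrow> 'a) \<Rightarrow> bool"
  where "globalizable K A G e B \<beta> \<phi> n w \<longleftrightarrow>
    (\<exists>u \<in> cocycles G (multiplier_algebra K B) (multiplier_action G B \<beta>) n.
      \<forall>gs\<in>tuples G n. \<phi> (w gs) = mult_right (\<phi> (tuple_unit A G e gs)) (u gs))"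

end

theory Submission
  imports Defs
begin

text \<open>An element \<open>b\<close> of \<open>B\<close> is determined by its components \<open>b\<^sub>t = \<phi>\<^sup>-\<^sup>1(\<phi>(1) \<beta>\<^sub>t(b))\<close> in \<open>A\<close>, and
  \<open>b \<mapsto> (b\<^sub>t)\<^sub>t\<close> is an injective homomorphism into functions from \<open>G\<close> to \<open>A\<close>, with
  \<open>(\<beta>\<^sub>g b)\<^sub>t = b\<^sub>t\<^sub>g\<close>. A family \<open>c\<close> of elements of \<open>A\<close> acts on \<open>B\<close> by a multiplier, through multiplication
  of components, as soon as \<open>\<alpha>\<^sub>x(e(x\<^sup>-\<^sup>1) c(s)) = e(x) c(xs)\<close>.

  Given a globalization \<open>u\<close>, put \<open>\<phi>(w') = \<phi>(1) u\<close>; the required identity is the cocycle identity of \<open>u\<close>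
  multiplied by \<open>\<phi>(e(g))\<close>, \<open>g\<close> being the first entry. Conversely, the cocycle identity of the
  desired \<open>u\<close> on \<open>(t, g\<^sub>1, \<dots>, g\<^sub>n)\<close> forces its components: \<open>c(t) = -(\<partial>w')(t, g\<^sub>1, \<dots>, g\<^sub>n)\<close>, where \<open>\<partial>\<close> is the
  coboundary without the term containing the action. That these families define multipliers and
  that \<open>u\<close> is a cocycle both amount to \<open>\<partial>\<partial>w' = 0\<close>.\<close>

section \<open>The coboundary without the action\<close>

lemma tuples_0 [simp]: "tuples G 0 = {[]}"
  by (auto simp: tuples_def)

lemma Nil_in_tuples [simp]: "[] \<in> tuples G n \<longleftrightarrow> n = 0"
  by (auto simp: tuples_def)

lemma Cons_in_tuples [simp]:
  "g # gs \<in> tuples G (Suc n) \<longleftrightarrow> g \<in> carrier G \<and> gs \<in> tuples G n"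
  by (auto simp: tuples_def)

lemma tuples_SucE:
  assumes "gs \<in> tuples G (Suc n)"
  obtains g hs where "gs = g # hs" "g \<in> carrier G" "hs \<in> tuples G n"
  using assms by (cases gs) (auto simp: tuples_def)

text \<open>The coboundary without its first term, which is the only one involving the action. The recursion
  gives \<open>\<partial>\<partial> = 0\<close> by induction, without manipulation of double sums.\<close>

fun tail_coboundary ::
  "('g, 'm) monoid_scheme \<Rightarrow> ('c, 's) ring_scheme \<Rightarrow> ('g list \<Rightarrow> 'c) \<Rightarrow> 'g list \<Rightarrow> 'c"
  where
    "tail_coboundary G M f [] = \<zero>\<^bsub>M\<^esub>"
  | "tail_coboundary G M f [g] = \<ominus>\<^bsub>M\<^esub> f []"
  | "tail_coboundary G M f (g # h # gs) =
      \<ominus>\<^bsub>M\<^esub> f (g \<otimes>\<^bsub>G\<^esub> h # gs) \<ominus>\<^bsub>M\<^esub> tail_coboundary G M (\<lambda>hs. f (g # hs)) (h # gs)"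

lemma merge_Cons: "i > 0 \<Longrightarrow> merge G (Suc i) (g # gs) = g # merge G i gs"
  by (cases i) (auto simp: merge_def)

lemma merge_1: "merge G (Suc 0) (g # h # gs) = g \<otimes>\<^bsub>G\<^esub> h # gs"
  by (simp add: merge_def)

text \<open>Shifting the index of the alternating sum by one flips every sign; this lemma supplies
  the flip.\<close>

lemma (in abelian_group) add_pow_neg_one_Suc:
  "x \<in> carrier G \<Longrightarrow> [((-1::int) ^ Suc i)] \<cdot> x = \<ominus> ([((-1::int) ^ i)] \<cdot> x)"
  using add.int_pow_neg[of x "(-1) ^ i"] by simp

lemma (in abelian_group) finsum_a_inv:
  assumes "finite I" "f \<in> I \<rightarrow> carrier G"
  shows "(\<Oplus>i\<in>I. \<ominus> f i) = \<ominus> (\<Oplus>i\<in>I. f i)"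
proof -
  have zero: "\<ominus> \<zero> = \<zero>"
    by (rule minus_equality) auto
  from assms show ?thesis
    by (induction I rule: finite_induct) (auto simp: zero Pi_def minus_add)
qed

text \<open>Only an additive group of coefficients is fixed, without any action on it. The
  coefficients will be \<open>A\<close>, \<open>B\<close> and the multiplier algebra.\<close>

locale group_coefficients = G: group G + M: abelian_group M
  for G (structure) and M (structure)
begin

lemma merge_closed:
  assumes "gs \<in> tuples G (Suc n)" "i \<in> {1..n}"
  shows "merge G i gs \<in> tuples G n"
  using assms
proof (induction n arbitrary: i gs)
  case (Suc n)
  from Suc.prems(1) obtain g h hs where gs: "gs = g # h # hs"
    and gh: "g \<in> carrier G" "h \<in> carrier G" "hs \<in> tuples G n"
    by (elim tuples_SucE) auto
  show ?case
  proof (cases "i = 1")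
    case True
    with gs gh show ?thesis by (simp add: merge_1)
  next
    case False
    \<comment> \<open>Merges beyond the first leave the first entry alone, so they are merges of
      \<open>h # hs\<close> at position \<open>j\<close>.\<close>
    with Suc.prems obtain j where "i = Suc j" "j \<in> {1..n}"
      by (cases i) auto
    with gs gh Suc.IH[of "h # hs" j] show ?thesis by (simp add: merge_Cons)
  qed
qed auto

lemma tail_coboundary_closed:
  assumes "gs \<in> tuples G (Suc n)" "f \<in> tuples G n \<rightarrow> carrier M"
  shows "tail_coboundary G M f gs \<in> carrier M"
  using assms
proof (induction n arbitrary: f gs)
  case (Suc n)
  from Suc.prems(1) obtain g h hs where gs: "gs = g # h # hs"
    and gh: "g \<in> carrier G" "h \<in> carrier G" "hs \<in> tuples G n"
    by (elim tuples_SucE) auto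
  then have "tail_coboundary G M (\<lambda>hs. f (g # hs)) (h # hs) \<in> carrier M"
    using Suc.prems by (intro Suc.IH) auto
  with gs gh Suc.prems show ?case by (auto simp: Pi_def)
qed (auto elim: tuples_SucE)

text \<open>Cochains matter only on tuples of the right length, so rewriting under
  \<open>tail_coboundary\<close> must be restricted to those; plain congruence would demand equality
  on all lists.\<close>

lemma tail_coboundary_cong:
  assumes "gs \<in> tuples G (Suc n)" "\<And>hs. hs \<in> tuples G n \<Longrightarrow> f hs = f' hs"
  shows "tail_coboundary G M f gs = tail_coboundary G M f' gs"
  using assms
proof (induction n arbitrary: f f' gs)
  case (Suc n)
  from Suc.prems(1) obtain g h hs where gs: "gs = g # h # hs"
    and gh: "g \<in> carrier G" "h \<in> carrier G" "hs \<in> tuples G n"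
    by (elim tuples_SucE) auto
  then have "tail_coboundary G M (\<lambda>hs. f (g # hs)) (h # hs)
      = tail_coboundary G M (\<lambda>hs. f' (g # hs)) (h # hs)"
    using Suc.prems by (intro Suc.IH) auto
  with gs gh Suc.prems show ?case by simp
qed (auto elim: tuples_SucE)

text \<open>The term for \<open>i = 1\<close> is the first summand of the recursion. The remaining
  merges and the \<open>butlast\<close> term keep the first entry \<open>g\<close>, so they form,
  with opposite sign, the same expression for \<open>\<lambda>hs. f (g # hs)\<close> on
  \<open>h # hs\<close>, to which the induction hypothesis applies.\<close>

lemma tail_coboundary_eq_sum:
  assumes "gs \<in> tuples G (Suc n)" "f \<in> tuples G n \<rightarrow> carrier M"
  shows "tail_coboundary G M f gs =
    (\<Oplus>\<^bsub>M\<^esub>i\<in>{1..n}. [((-1::int) ^ i)] \<cdot>\<^bsub>M\<^esub> f (merge G i gs))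
    \<oplus>\<^bsub>M\<^esub> [((-1::int) ^ (n + 1))] \<cdot>\<^bsub>M\<^esub> f (butlast gs)"
  using assms
proof (induction n arbitrary: f gs)
  case 0
  then show ?case
    by (auto elim!: tuples_SucE simp: M.add_pow_neg_one_Suc[of _ 0, simplified])
next
  case (Suc n)
  from Suc.prems(1) obtain g h hs where gs: "gs = g # h # hs"
    and gh: "g \<in> carrier G" "h \<in> carrier G" "hs \<in> tuples G n"
    by (elim tuples_SucE) auto
  let ?t = "\<lambda>i. [((-1::int) ^ i)] \<cdot>\<^bsub>M\<^esub> f (merge G i gs)"
  let ?s = "\<lambda>i. [((-1::int) ^ i)] \<cdot>\<^bsub>M\<^esub> f (g # merge G i (h # hs))"
  have f: "f hs' \<in> carrier M" if "hs' \<in> tuples G (Suc n)" for hs'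
    using that Suc.prems by blast
  have m: "f (merge G i gs) \<in> carrier M" if "i \<in> {1..Suc n}" for i
    using f merge_closed[OF Suc.prems(1) that] by blast
  have m': "f (g # merge G i (h # hs)) \<in> carrier M" if "i \<in> {1..n}" for i
    using f merge_closed[OF _ that, of "h # hs"] gh by simp
  have b: "butlast (h # hs) \<in> tuples G n"
    using gh by (auto simp: tuples_def dest: in_set_butlastD)
  have eq: "{1..Suc n} = insert 1 (Suc ` {1..n})"
    by (auto simp: image_Suc_atLeastAtMost)
  have "(\<Oplus>\<^bsub>M\<^esub>i\<in>{1..Suc n}. ?t i) = ?t 1 \<oplus>\<^bsub>M\<^esub> (\<Oplus>\<^bsub>M\<^esub>i\<in>Suc ` {1..n}. ?t i)"
    unfolding eq using m by (intro M.finsum_insert) (auto simp: eq)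
  also have "(\<Oplus>\<^bsub>M\<^esub>i\<in>Suc ` {1..n}. ?t i) = (\<Oplus>\<^bsub>M\<^esub>i\<in>{1..n}. ?t (Suc i))"
    using m by (intro M.finsum_reindex) auto
  also have "\<dots> = (\<Oplus>\<^bsub>M\<^esub>i\<in>{1..n}. \<ominus>\<^bsub>M\<^esub> ?s i)"
    using m' by (intro M.finsum_cong')
      (auto simp: gs merge_Cons M.add_pow_neg_one_Suc simp del: power_Suc)
  also have "\<dots> = \<ominus>\<^bsub>M\<^esub> (\<Oplus>\<^bsub>M\<^esub>i\<in>{1..n}. ?s i)"
    using m' by (intro M.finsum_a_inv) auto
  also have "?t 1 = \<ominus>\<^bsub>M\<^esub> f (g \<otimes> h # hs)"
    using M.add_pow_neg_one_Suc[of "f (g \<otimes> h # hs)" 0] f gh by (simp add: gs merge_1)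
  finally have "(\<Oplus>\<^bsub>M\<^esub>i\<in>{1..Suc n}. ?t i)
      = \<ominus>\<^bsub>M\<^esub> f (g \<otimes> h # hs) \<oplus>\<^bsub>M\<^esub> \<ominus>\<^bsub>M\<^esub> (\<Oplus>\<^bsub>M\<^esub>i\<in>{1..n}. ?s i)" .
  moreover have "[((-1::int) ^ (Suc n + 1))] \<cdot>\<^bsub>M\<^esub> f (butlast gs)
      = \<ominus>\<^bsub>M\<^esub> ([((-1::int) ^ (n + 1))] \<cdot>\<^bsub>M\<^esub> f (g # butlast (h # hs)))"
    using M.add_pow_neg_one_Suc[of _ "Suc n"] f gh b by (simp add: gs del: power_Suc)
  moreover have "tail_coboundary G M (\<lambda>hs. f (g # hs)) (h # hs)
      = (\<Oplus>\<^bsub>M\<^esub>i\<in>{1..n}. ?s i) \<oplus>\<^bsub>M\<^esub> [((-1::int) ^ (n + 1))] \<cdot>\<^bsub>M\<^esub> f (g # butlast (h # hs))"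
    using gh Suc.prems by (intro Suc.IH) auto
  moreover have "(\<Oplus>\<^bsub>M\<^esub>i\<in>{1..n}. ?s i) \<in> carrier M"
    using m' by (intro M.finsum_closed) auto
  moreover have "[((-1::int) ^ (n + 1))] \<cdot>\<^bsub>M\<^esub> f (g # butlast (h # hs)) \<in> carrier M"
    using f gh b by (intro M.add.int_pow_closed) auto
  ultimately show ?case
    using gh f by (simp add: gs a_minus_def M.minus_add M.a_assoc del: power_Suc butlast.simps)
qed

text \<open>The signs are those of the third recursion equation, so \<open>tail_coboundary\<close>
  can be applied to a cochain that is itself an unfolded \<open>tail_coboundary\<close>.\<close>

lemma tail_coboundary_minus_minus:
  assumes "gs \<in> tuples G (Suc n)" "p \<in> tuples G n \<rightarrow> carrier M" "q \<in> tuples G n \<rightarrow> carrier M"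
  shows "tail_coboundary G M (\<lambda>hs. \<ominus>\<^bsub>M\<^esub> p hs \<ominus>\<^bsub>M\<^esub> q hs) gs
    = \<ominus>\<^bsub>M\<^esub> tail_coboundary G M p gs \<ominus>\<^bsub>M\<^esub> tail_coboundary G M q gs"
  using assms
proof (induction n arbitrary: p q gs)
  case 0
  then show ?case by (auto elim!: tuples_SucE simp: a_minus_def M.minus_add)
next
  case (Suc n)
  from Suc.prems(1) obtain g h hs where gs: "gs = g # h # hs"
    and gh: "g \<in> carrier G" "h \<in> carrier G" "hs \<in> tuples G n"
    by (elim tuples_SucE) auto
  let ?p = "tail_coboundary G M (\<lambda>hs. p (g # hs)) (h # hs)"
  let ?q = "tail_coboundary G M (\<lambda>hs. q (g # hs)) (h # hs)"
  have "tail_coboundary G M (\<lambda>hs. \<ominus>\<^bsub>M\<^esub> p (g # hs) \<ominus>\<^bsub>M\<^esub> q (g # hs)) (h # hs)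
      = \<ominus>\<^bsub>M\<^esub> ?p \<ominus>\<^bsub>M\<^esub> ?q"
    using gh Suc.prems by (intro Suc.IH) auto
  moreover have "?p \<in> carrier M" "?q \<in> carrier M"
    using gh Suc.prems by (auto intro!: tail_coboundary_closed[where n = n])
  moreover have "p (g \<otimes> h # hs) \<in> carrier M" "q (g \<otimes> h # hs) \<in> carrier M"
    using gh Suc.prems by auto
  ultimately show ?case
    by (simp add: gs a_minus_def M.minus_add M.a_ac)
qed

text \<open>This is \<open>\<partial>\<partial>f = 0\<close> at \<open>x # s # gs\<close>, with the
  outer \<partial> unfolded once and the sign reversed. After further unfolding, the terms
  \<open>a\<close> and \<open>b\<close> cancel, and the remaining sum of \<open>c\<close> and
  \<open>d\<close> is an instance of the claim for the cochain with first entry \<open>x\<close>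
  fixed.\<close>

lemma tail_coboundary_square:
  assumes "x \<in> carrier G" "s \<in> carrier G" "gs \<in> tuples G n" "f \<in> tuples G n \<rightarrow> carrier M"
  shows "tail_coboundary G M f (x \<otimes> s # gs)
    \<oplus>\<^bsub>M\<^esub> tail_coboundary G M (\<lambda>hs. tail_coboundary G M f (x # hs)) (s # gs) = \<zero>\<^bsub>M\<^esub>"
  using assms
proof (induction n arbitrary: f x s gs)
  case 0
  then show ?case by (auto simp: M.l_neg)
next
  case (Suc n)
  from Suc.prems(3) obtain g hs where gs: "gs = g # hs"
    and gh: "g \<in> carrier G" "hs \<in> tuples G n"
    by (elim tuples_SucE) auto
  have f: "f hs' \<in> carrier M" if "hs' \<in> tuples G (Suc n)" for hs'
    using that Suc.prems by blast
  have fx: "(\<lambda>hs. f (y # hs)) \<in> tuples G n \<rightarrow> carrier M" if "y \<in> carrier G" for y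
    using f that by auto
  define a where "a = f (x \<otimes> s \<otimes> g # hs)"
  define b where "b = tail_coboundary G M (\<lambda>hs. f (x \<otimes> s # hs)) (g # hs)"
  define c where "c = tail_coboundary G M (\<lambda>hs. f (x # hs)) (s \<otimes> g # hs)"
  define d where "d = tail_coboundary G M
    (\<lambda>ks. tail_coboundary G M (\<lambda>hs. f (x # hs)) (s # ks)) (g # hs)"
  have carr: "a \<in> carrier M" "b \<in> carrier M" "c \<in> carrier M" "d \<in> carrier M"
    unfolding a_def b_def c_def d_def using Suc.prems f fx gh
    by (auto intro!: tail_coboundary_closed[where n = n])
  have "tail_coboundary G M (\<lambda>ks. tail_coboundary G M f (x # s # ks)) (g # hs)
      = \<ominus>\<^bsub>M\<^esub> b \<ominus>\<^bsub>M\<^esub> d"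
    unfolding b_def d_def tail_coboundary.simps
    using Suc.prems f fx gh
    by (intro tail_coboundary_minus_minus[where n = n])
      (auto intro!: tail_coboundary_closed[where n = n])
  then have "tail_coboundary G M (\<lambda>hs. tail_coboundary G M f (x # hs)) (s # g # hs)
      = \<ominus>\<^bsub>M\<^esub> (\<ominus>\<^bsub>M\<^esub> a \<ominus>\<^bsub>M\<^esub> c) \<ominus>\<^bsub>M\<^esub> (\<ominus>\<^bsub>M\<^esub> b \<ominus>\<^bsub>M\<^esub> d)"
    using Suc.prems gh by (simp add: a_def c_def G.m_assoc)
  moreover have "tail_coboundary G M f (x \<otimes> s # g # hs) = \<ominus>\<^bsub>M\<^esub> a \<ominus>\<^bsub>M\<^esub> b"
    by (simp add: a_def b_def)
  \<comment> \<open>The induction hypothesis, with \<open>s\<close> and \<open>g\<close> in the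
    roles of \<open>x\<close> and \<open>s\<close>.\<close>
  moreover have "c \<oplus>\<^bsub>M\<^esub> d = \<zero>\<^bsub>M\<^esub>"
    unfolding c_def d_def using Suc.prems gh fx by (intro Suc.IH) auto
  moreover have "\<ominus>\<^bsub>M\<^esub> (\<ominus>\<^bsub>M\<^esub> a \<ominus>\<^bsub>M\<^esub> c) \<ominus>\<^bsub>M\<^esub> (\<ominus>\<^bsub>M\<^esub> b \<ominus>\<^bsub>M\<^esub> d)
      = \<ominus>\<^bsub>M\<^esub> (\<ominus>\<^bsub>M\<^esub> a \<ominus>\<^bsub>M\<^esub> b) \<oplus>\<^bsub>M\<^esub> (c \<oplus>\<^bsub>M\<^esub> d)"
    using carr by (simp add: a_minus_def M.minus_add M.a_ac)
  moreover have "\<ominus>\<^bsub>M\<^esub> a \<ominus>\<^bsub>M\<^esub> b \<in> carrier M"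
    using carr by simp
  ultimately show ?case by (simp add: gs M.r_neg)
qed

end

text \<open>Naturality in the coefficients. Every later transport of the coboundary is an instance:
  multiplication by an element, negation, \<open>\<alpha>e\<close>, \<open>\<phi>\<close>,
  evaluation of a multiplier, and a component of an evaluated multiplier.\<close>

lemma tail_coboundary_hom:
  assumes "group_coefficients G M" "group_coefficients G N"
    and h: "h \<in> hom (add_monoid M) (add_monoid N)"
    and "gs \<in> tuples G (Suc n)" "f \<in> tuples G n \<rightarrow> carrier M"
  shows "h (tail_coboundary G M f gs) = tail_coboundary G N (\<lambda>hs. h (f hs)) gs"
proof -
  interpret M: group_coefficients G M by fact
  interpret N: group_coefficients G N by fact
  interpret h: group_hom "add_monoid M" "add_monoid N" h
    using h by (intro group_hom.intro group_hom_axioms.intro M.M.a_group N.M.a_group)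
  have add: "h (x \<oplus>\<^bsub>M\<^esub> y) = h x \<oplus>\<^bsub>N\<^esub> h y" if "x \<in> carrier M" "y \<in> carrier M" for x y
    using h.hom_mult that by simp
  have inv: "h (\<ominus>\<^bsub>M\<^esub> x) = \<ominus>\<^bsub>N\<^esub> h x" if "x \<in> carrier M" for x
    using h.hom_inv that by (simp add: a_inv_def)
  show ?thesis
    using assms(4,5)
  proof (induction n arbitrary: f gs)
    case 0
    then show ?case by (auto elim!: tuples_SucE simp: inv)
  next
    case (Suc n)
    from Suc.prems(1) obtain g k hs where gs: "gs = g # k # hs"
      and gh: "g \<in> carrier G" "k \<in> carrier G" "hs \<in> tuples G n"
      by (elim tuples_SucE) auto
    let ?p = "tail_coboundary G M (\<lambda>hs. f (g # hs)) (k # hs)"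
    have "h ?p = tail_coboundary G N (\<lambda>hs. h (f (g # hs))) (k # hs)"
      using gh Suc.prems by (intro Suc.IH) auto
    moreover have "?p \<in> carrier M"
      using gh Suc.prems by (auto intro!: M.tail_coboundary_closed[where n = n])
    moreover have "f (g \<otimes>\<^bsub>G\<^esub> k # hs) \<in> carrier M"
      using gh Suc.prems by auto
    ultimately show ?case
      by (simp add: gs a_minus_def add inv)
  qed
qed

section \<open>The additive group of multipliers\<close>

context assoc_algebra
begin

lemma mult_zero_right:
  assumes "x \<in> carrier A"
  shows "x \<otimes>\<^bsub>A\<^esub> \<zero>\<^bsub>A\<^esub> = \<zero>\<^bsub>A\<^esub>"
proof -
  have "x \<otimes>\<^bsub>A\<^esub> \<zero>\<^bsub>A\<^esub> \<oplus>\<^bsub>A\<^esub> x \<otimes>\<^bsub>A\<^esub> \<zero>\<^bsub>A\<^esub> = x \<otimes>\<^bsub>A\<^esub> \<zero>\<^bsub>A\<^esub>"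
    using assms mult_r_distr[of "\<zero>\<^bsub>A\<^esub>" "\<zero>\<^bsub>A\<^esub>" x] by simp
  then show ?thesis
    using assms by (simp add: mult_closed)
qed

lemma mult_zero_left:
  assumes "x \<in> carrier A"
  shows "\<zero>\<^bsub>A\<^esub> \<otimes>\<^bsub>A\<^esub> x = \<zero>\<^bsub>A\<^esub>"
proof -
  have "\<zero>\<^bsub>A\<^esub> \<otimes>\<^bsub>A\<^esub> x \<oplus>\<^bsub>A\<^esub> \<zero>\<^bsub>A\<^esub> \<otimes>\<^bsub>A\<^esub> x = \<zero>\<^bsub>A\<^esub> \<otimes>\<^bsub>A\<^esub> x"
    using assms mult_l_distr[of "\<zero>\<^bsub>A\<^esub>" "\<zero>\<^bsub>A\<^esub>" x] by simp
  then show ?thesis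
    using assms by (simp add: mult_closed)
qed

lemma mult_minus_right:
  assumes "x \<in> carrier A" "y \<in> carrier A"
  shows "x \<otimes>\<^bsub>A\<^esub> (\<ominus>\<^bsub>A\<^esub> y) = \<ominus>\<^bsub>A\<^esub> (x \<otimes>\<^bsub>A\<^esub> y)"
  using assms mult_r_distr[of "\<ominus>\<^bsub>A\<^esub> y" y x]
  by (intro M.minus_equality[symmetric]) (auto simp: M.l_neg mult_zero_right mult_closed)

lemma mult_minus_left:
  assumes "x \<in> carrier A" "y \<in> carrier A"
  shows "(\<ominus>\<^bsub>A\<^esub> x) \<otimes>\<^bsub>A\<^esub> y = \<ominus>\<^bsub>A\<^esub> (x \<otimes>\<^bsub>A\<^esub> y)"
  using assms mult_l_distr[of "\<ominus>\<^bsub>A\<^esub> x" x y]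
  by (intro M.minus_equality[symmetric]) (auto simp: M.l_neg mult_zero_left mult_closed)

lemma multiplier_carrier_iff:
  "\<gamma> \<in> carrier (multiplier_algebra K A) \<longleftrightarrow>
    fst \<gamma> \<in> left_module_endos K A \<and> snd \<gamma> \<in> right_module_endos K A \<and>
    (\<forall>a\<in>carrier A. \<forall>b\<in>carrier A. fst \<gamma> a \<otimes>\<^bsub>A\<^esub> b = a \<otimes>\<^bsub>A\<^esub> snd \<gamma> b)"
  by (cases \<gamma>) (simp add: multiplier_algebra_def)

lemma multiplier_add:
  "\<gamma> \<oplus>\<^bsub>multiplier_algebra K A\<^esub> \<gamma>' =
    (\<lambda>b\<in>carrier A. fst \<gamma> b \<oplus>\<^bsub>A\<^esub> fst \<gamma>' b, \<lambda>b\<in>carrier A. snd \<gamma> b \<oplus>\<^bsub>A\<^esub> snd \<gamma>' b)"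
  by (simp add: multiplier_algebra_def split: prod.split)

lemma multiplier_zero:
  "\<zero>\<^bsub>multiplier_algebra K A\<^esub> = (\<lambda>b\<in>carrier A. \<zero>\<^bsub>A\<^esub>, \<lambda>b\<in>carrier A. \<zero>\<^bsub>A\<^esub>)"
  by (simp add: multiplier_algebra_def)

text \<open>Both halves of a multiplier are extensional, so they are determined by their values on
  \<open>carrier A\<close>.\<close>

lemma multiplier_eqI:
  assumes "\<gamma> \<in> carrier (multiplier_algebra K A)" "\<gamma>' \<in> carrier (multiplier_algebra K A)"
    and "\<And>b. b \<in> carrier A \<Longrightarrow> fst \<gamma> b = fst \<gamma>' b"
    and "\<And>b. b \<in> carrier A \<Longrightarrow> snd \<gamma> b = snd \<gamma>' b"
  shows "\<gamma> = \<gamma>'"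
  using assms
  by (intro prod_eqI PiE_ext[where k = "carrier A" and s = "\<lambda>_. carrier A"])
    (auto simp: multiplier_carrier_iff left_module_endos_def right_module_endos_def)

lemma multiplier_fst_closed:
  "\<lbrakk>\<gamma> \<in> carrier (multiplier_algebra K A); b \<in> carrier A\<rbrakk> \<Longrightarrow> fst \<gamma> b \<in> carrier A"
  by (auto simp: multiplier_carrier_iff left_module_endos_def)

lemma multiplier_snd_closed:
  "\<lbrakk>\<gamma> \<in> carrier (multiplier_algebra K A); b \<in> carrier A\<rbrakk> \<Longrightarrow> snd \<gamma> b \<in> carrier A"
  by (auto simp: multiplier_carrier_iff right_module_endos_def)

lemma abelian_group_multiplier_algebra: "abelian_group (multiplier_algebra K A)"
proof (rule abelian_groupI)
  fix \<gamma> \<gamma>'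
  assume \<gamma>: "\<gamma> \<in> carrier (multiplier_algebra K A)" and \<gamma>': "\<gamma>' \<in> carrier (multiplier_algebra K A)"
  show "\<gamma> \<oplus>\<^bsub>multiplier_algebra K A\<^esub> \<gamma>' \<in> carrier (multiplier_algebra K A)"
    using \<gamma> \<gamma>' multiplier_fst_closed[OF \<gamma>] multiplier_snd_closed[OF \<gamma>]
      multiplier_fst_closed[OF \<gamma>'] multiplier_snd_closed[OF \<gamma>']
    unfolding multiplier_add multiplier_carrier_iff
    by (auto simp: left_module_endos_def right_module_endos_def smult_r_distr
        mult_l_distr mult_r_distr mult_closed M.a_ac)
  show "\<gamma> \<oplus>\<^bsub>multiplier_algebra K A\<^esub> \<gamma>' = \<gamma>' \<oplus>\<^bsub>multiplier_algebra K A\<^esub> \<gamma>"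
    using \<gamma> \<gamma>' by (auto simp: multiplier_add multiplier_fst_closed multiplier_snd_closed M.a_ac
        intro!: restrict_ext)
next
  fix \<gamma> \<gamma>' \<gamma>''
  assume "\<gamma> \<in> carrier (multiplier_algebra K A)" "\<gamma>' \<in> carrier (multiplier_algebra K A)"
    "\<gamma>'' \<in> carrier (multiplier_algebra K A)"
  then show "\<gamma> \<oplus>\<^bsub>multiplier_algebra K A\<^esub> \<gamma>' \<oplus>\<^bsub>multiplier_algebra K A\<^esub> \<gamma>''
    = \<gamma> \<oplus>\<^bsub>multiplier_algebra K A\<^esub> (\<gamma>' \<oplus>\<^bsub>multiplier_algebra K A\<^esub> \<gamma>'')"
    by (auto simp: multiplier_add multiplier_fst_closed multiplier_snd_closed M.a_ac
        intro!: restrict_ext)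
next
  show zero: "\<zero>\<^bsub>multiplier_algebra K A\<^esub> \<in> carrier (multiplier_algebra K A)"
    unfolding multiplier_zero multiplier_carrier_iff
    by (auto simp: left_module_endos_def right_module_endos_def mult_closed
        mult_zero_left mult_zero_right)
  fix \<gamma> assume \<gamma>: "\<gamma> \<in> carrier (multiplier_algebra K A)"
  \<comment> \<open>Adding zero returns restricted functions, so the neutral law rests on
    extensionality.\<close>
  then have ext: "(\<lambda>b\<in>carrier A. fst \<gamma> b) = fst \<gamma>" "(\<lambda>b\<in>carrier A. snd \<gamma> b) = snd \<gamma>"
    by (auto simp: multiplier_carrier_iff left_module_endos_def right_module_endos_def
        PiE_def extensional_restrict)
  have "\<zero>\<^bsub>multiplier_algebra K A\<^esub> \<oplus>\<^bsub>multiplier_algebra K A\<^esub> \<gamma>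
      = (\<lambda>b\<in>carrier A. fst \<gamma> b, \<lambda>b\<in>carrier A. snd \<gamma> b)"
    using \<gamma> by (auto simp: multiplier_add multiplier_zero multiplier_fst_closed
        multiplier_snd_closed intro!: restrict_ext)
  then show "\<zero>\<^bsub>multiplier_algebra K A\<^esub> \<oplus>\<^bsub>multiplier_algebra K A\<^esub> \<gamma> = \<gamma>"
    by (simp add: ext)
  let ?n = "(\<lambda>b\<in>carrier A. \<ominus>\<^bsub>A\<^esub> fst \<gamma> b, \<lambda>b\<in>carrier A. \<ominus>\<^bsub>A\<^esub> snd \<gamma> b)"
  have "?n \<in> carrier (multiplier_algebra K A)"
    using \<gamma> multiplier_fst_closed[OF \<gamma>] multiplier_snd_closed[OF \<gamma>]
    unfolding multiplier_carrier_iff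
    by (auto simp: left_module_endos_def right_module_endos_def mult_closed
        mult_minus_left mult_minus_right smult_r_minus M.minus_add)
  moreover have "?n \<oplus>\<^bsub>multiplier_algebra K A\<^esub> \<gamma> = \<zero>\<^bsub>multiplier_algebra K A\<^esub>"
    using \<gamma> by (auto simp: multiplier_add multiplier_zero multiplier_fst_closed
        multiplier_snd_closed M.l_neg intro!: restrict_ext)
  ultimately show "\<exists>\<gamma>'\<in>carrier (multiplier_algebra K A).
      \<gamma>' \<oplus>\<^bsub>multiplier_algebra K A\<^esub> \<gamma> = \<zero>\<^bsub>multiplier_algebra K A\<^esub>"
    by blast
qed

text \<open>Evaluation at a fixed \<open>b\<close> is additive, so it passes through
  \<open>tail_coboundary\<close>; this turns identities between multipliers into identities in the
  algebra.\<close>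

lemma multiplier_fst_hom:
  "b \<in> carrier A \<Longrightarrow> (\<lambda>\<gamma>. fst \<gamma> b) \<in> hom (add_monoid (multiplier_algebra K A)) (add_monoid A)"
  by (auto simp: hom_def multiplier_add multiplier_fst_closed)

lemma multiplier_snd_hom:
  "b \<in> carrier A \<Longrightarrow> (\<lambda>\<gamma>. snd \<gamma> b) \<in> hom (add_monoid (multiplier_algebra K A)) (add_monoid A)"
  by (auto simp: hom_def multiplier_add multiplier_snd_closed)

end

section \<open>The action of the group on multipliers\<close>

context global_action
begin

lemma \<beta>_closed: "\<lbrakk>g \<in> carrier G; b \<in> carrier B\<rbrakk> \<Longrightarrow> \<beta> g b \<in> carrier B"
  using \<beta>_auto[of g] by (auto simp: algebra_iso_def algebra_hom_def hom_def)

lemma \<beta>_add: "\<lbrakk>g \<in> carrier G; b \<in> carrier B; c \<in> carrier B\<rbrakk>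
    \<Longrightarrow> \<beta> g (b \<oplus>\<^bsub>B\<^esub> c) = \<beta> g b \<oplus>\<^bsub>B\<^esub> \<beta> g c"
  using \<beta>_auto[of g] by (auto simp: algebra_iso_def algebra_hom_def hom_def)

lemma \<beta>_mult: "\<lbrakk>g \<in> carrier G; b \<in> carrier B; c \<in> carrier B\<rbrakk>
    \<Longrightarrow> \<beta> g (b \<otimes>\<^bsub>B\<^esub> c) = \<beta> g b \<otimes>\<^bsub>B\<^esub> \<beta> g c"
  using \<beta>_auto[of g] by (auto simp: algebra_iso_def algebra_hom_def hom_def)

lemma \<beta>_smult: "\<lbrakk>g \<in> carrier G; k \<in> carrier K; b \<in> carrier B\<rbrakk>
    \<Longrightarrow> \<beta> g (k \<odot>\<^bsub>B\<^esub> b) = k \<odot>\<^bsub>B\<^esub> \<beta> g b"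
  using \<beta>_auto[of g] by (auto simp: algebra_iso_def algebra_hom_def)

lemma \<beta>_inv_left: "\<lbrakk>g \<in> carrier G; b \<in> carrier B\<rbrakk> \<Longrightarrow> \<beta> (inv\<^bsub>G\<^esub> g) (\<beta> g b) = b"
  by (simp add: \<beta>_comp \<beta>_one)

lemma \<beta>_inv_right: "\<lbrakk>g \<in> carrier G; b \<in> carrier B\<rbrakk> \<Longrightarrow> \<beta> g (\<beta> (inv\<^bsub>G\<^esub> g) b) = b"
  by (simp add: \<beta>_comp \<beta>_one)

text \<open>Conjugation preserves the link between the two halves: write the product as the image
  under \<beta> of a product, exchange the halves there, and distribute \<beta> again.\<close>

lemma multiplier_action_closed:
  assumes g: "g \<in> carrier G" and \<gamma>: "\<gamma> \<in> carrier (multiplier_algebra K B)"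
  shows "multiplier_action G B \<beta> g \<gamma> \<in> carrier (multiplier_algebra K B)"
proof -
  have "\<beta> g (fst \<gamma> (\<beta> (inv\<^bsub>G\<^esub> g) a)) \<otimes>\<^bsub>B\<^esub> b = a \<otimes>\<^bsub>B\<^esub> \<beta> g (snd \<gamma> (\<beta> (inv\<^bsub>G\<^esub> g) b))"
    if ab: "a \<in> carrier B" "b \<in> carrier B" for a b
  proof -
    have cl: "\<beta> (inv\<^bsub>G\<^esub> g) a \<in> carrier B" "\<beta> (inv\<^bsub>G\<^esub> g) b \<in> carrier B"
      using g ab by (simp_all add: \<beta>_closed)
    have "\<beta> g (fst \<gamma> (\<beta> (inv\<^bsub>G\<^esub> g) a)) \<otimes>\<^bsub>B\<^esub> b
        = \<beta> g (fst \<gamma> (\<beta> (inv\<^bsub>G\<^esub> g) a) \<otimes>\<^bsub>B\<^esub> \<beta> (inv\<^bsub>G\<^esub> g) b)"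
      using g ab \<gamma> cl by (simp add: \<beta>_mult \<beta>_inv_right multiplier_fst_closed)
    also have "\<dots> = \<beta> g (\<beta> (inv\<^bsub>G\<^esub> g) a \<otimes>\<^bsub>B\<^esub> snd \<gamma> (\<beta> (inv\<^bsub>G\<^esub> g) b))"
      using \<gamma> cl by (simp add: multiplier_carrier_iff)
    also have "\<dots> = a \<otimes>\<^bsub>B\<^esub> \<beta> g (snd \<gamma> (\<beta> (inv\<^bsub>G\<^esub> g) b))"
      using g ab \<gamma> cl by (simp add: \<beta>_mult \<beta>_inv_right multiplier_snd_closed)
    finally show ?thesis .
  qed
  with g \<gamma> multiplier_fst_closed[OF \<gamma>] multiplier_snd_closed[OF \<gamma>] show ?thesis
    unfolding multiplier_carrier_iff
    by (auto simp: multiplier_action_def left_module_endos_def right_module_endos_def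
        split_beta \<beta>_closed \<beta>_add \<beta>_smult \<beta>_mult \<beta>_inv_right mult_closed)
qed

text \<open>Isolates the action term. What remains is \<open>tail_coboundary\<close> written as a
  sum, so only the bracketing changes.\<close>

lemma coboundary_eq_tail:
  assumes "u \<in> tuples G n \<rightarrow> carrier (multiplier_algebra K B)" "gs \<in> tuples G (Suc n)"
  shows "coboundary G (multiplier_algebra K B) (multiplier_action G B \<beta>) n u gs
    = multiplier_action G B \<beta> (hd gs) (u (tl gs))
      \<oplus>\<^bsub>multiplier_algebra K B\<^esub> tail_coboundary G (multiplier_algebra K B) u gs"
proof -
  interpret m: group_coefficients G "multiplier_algebra K B"
    by (intro group_coefficients.intro abelian_group_multiplier_algebra G.is_group)
  have "butlast gs \<in> tuples G n"
    using assms(2) by (auto simp: tuples_def dest: in_set_butlastD)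
  moreover have "multiplier_action G B \<beta> (hd gs) (u (tl gs)) \<in> carrier (multiplier_algebra K B)"
    using assms by (auto elim!: tuples_SucE intro!: multiplier_action_closed)
  moreover have "(\<lambda>i. [((-1::int) ^ i)] \<cdot>\<^bsub>multiplier_algebra K B\<^esub> u (merge G i gs))
      \<in> {1..n} \<rightarrow> carrier (multiplier_algebra K B)"
    using assms m.merge_closed[OF assms(2)] by (auto intro!: m.M.add.int_pow_closed)
  ultimately show ?thesis
    using assms unfolding coboundary_def
    by (subst m.tail_coboundary_eq_sum[OF assms(2,1)], subst m.M.a_assoc)
      (auto intro!: m.M.add.int_pow_closed m.M.finsum_closed)
qed

end

section \<open>Components of elements of the enveloping algebra\<close>

context unital_partial_action
begin

text \<open>Cutting down by the idempotent first makes the partial isomorphism applicable to every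
  element of \<open>A\<close>; the result stays additive, and it stays multiplicative because the
  idempotent is central.\<close>

abbreviation \<alpha>e :: "'g \<Rightarrow> 'a \<Rightarrow> 'a"
  where "\<alpha>e g a \<equiv> \<alpha> g (e (inv\<^bsub>G\<^esub> g) \<otimes>\<^bsub>A\<^esub> a)"

lemma D_subset: "g \<in> carrier G \<Longrightarrow> D g \<subseteq> carrier A"
  by (auto simp: D_eq e_closed)

lemma e_mult_in_D: "\<lbrakk>g \<in> carrier G; a \<in> carrier A\<rbrakk> \<Longrightarrow> e g \<otimes>\<^bsub>A\<^esub> a \<in> D g"
  by (auto simp: D_eq)

lemma e_in_D: "g \<in> carrier G \<Longrightarrow> e g \<in> D g"
  using e_mult_in_D[of g "e g"] by (simp add: e_closed e_idem)

lemma e_mult_D: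
  assumes "g \<in> carrier G" "a \<in> D g"
  shows "e g \<otimes>\<^bsub>A\<^esub> a = a"
proof -
  from assms obtain b where "b \<in> carrier A" "a = e g \<otimes>\<^bsub>A\<^esub> b"
    by (auto simp: D_eq)
  with assms(1) show ?thesis
    by (simp add: e_closed e_idem flip: m_assoc)
qed

lemma \<alpha>_closed: "\<lbrakk>g \<in> carrier G; a \<in> D (inv\<^bsub>G\<^esub> g)\<rbrakk> \<Longrightarrow> \<alpha> g a \<in> D g"
  using \<alpha>_iso[of g] by (auto simp: algebra_iso_def algebra_hom_def hom_def)

lemma \<alpha>_mult: "\<lbrakk>g \<in> carrier G; a \<in> D (inv\<^bsub>G\<^esub> g); b \<in> D (inv\<^bsub>G\<^esub> g)\<rbrakk>
    \<Longrightarrow> \<alpha> g (a \<otimes>\<^bsub>A\<^esub> b) = \<alpha> g a \<otimes>\<^bsub>A\<^esub> \<alpha> g b"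
  using \<alpha>_iso[of g] by (auto simp: algebra_iso_def algebra_hom_def hom_def)

lemma \<alpha>_add: "\<lbrakk>g \<in> carrier G; a \<in> D (inv\<^bsub>G\<^esub> g); b \<in> D (inv\<^bsub>G\<^esub> g)\<rbrakk>
    \<Longrightarrow> \<alpha> g (a \<oplus>\<^bsub>A\<^esub> b) = \<alpha> g a \<oplus>\<^bsub>A\<^esub> \<alpha> g b"
  using \<alpha>_iso[of g] by (auto simp: algebra_iso_def algebra_hom_def hom_def)

text \<open>An isomorphism of ideals carries identity to identity: surjectivity yields a preimage
  \<open>z\<close> of \<open>e g\<close>, and the identity of the source ideal fixes
  \<open>z\<close>.\<close>

lemma \<alpha>_e:
  assumes g: "g \<in> carrier G"
  shows "\<alpha> g (e (inv\<^bsub>G\<^esub> g)) = e g"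
proof -
  have "\<alpha> g ` D (inv\<^bsub>G\<^esub> g) = D g"
    using \<alpha>_iso[OF g] by (simp add: algebra_iso_def bij_betw_def)
  then obtain z where z: "z \<in> D (inv\<^bsub>G\<^esub> g)" "e g = \<alpha> g z"
    using e_in_D[OF g] by auto
  have ei: "e (inv\<^bsub>G\<^esub> g) \<in> D (inv\<^bsub>G\<^esub> g)"
    using g by (simp add: e_in_D)
  then have cl: "\<alpha> g (e (inv\<^bsub>G\<^esub> g)) \<in> D g"
    using g by (simp add: \<alpha>_closed)
  then have "\<alpha> g (e (inv\<^bsub>G\<^esub> g)) = e g \<otimes>\<^bsub>A\<^esub> \<alpha> g (e (inv\<^bsub>G\<^esub> g))"
    using g by (simp add: e_mult_D)
  also have "\<dots> = \<alpha> g (e (inv\<^bsub>G\<^esub> g)) \<otimes>\<^bsub>A\<^esub> e g"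
    using e_central[OF g] D_subset[OF g] cl by blast
  also have "\<dots> = \<alpha> g (e (inv\<^bsub>G\<^esub> g) \<otimes>\<^bsub>A\<^esub> z)"
    using g z ei by (simp add: \<alpha>_mult)
  also have "\<dots> = e g"
    using g z by (simp add: e_mult_D)
  finally show ?thesis .
qed

lemma \<alpha>e_closed: "\<lbrakk>g \<in> carrier G; a \<in> carrier A\<rbrakk> \<Longrightarrow> \<alpha>e g a \<in> carrier A"
  using \<alpha>_closed[of g] D_subset[of g] by (auto simp: e_mult_in_D)

lemma e_mult_\<alpha>e: "\<lbrakk>g \<in> carrier G; a \<in> carrier A\<rbrakk> \<Longrightarrow> e g \<otimes>\<^bsub>A\<^esub> \<alpha>e g a = \<alpha>e g a"
  by (simp add: e_mult_D \<alpha>_closed e_mult_in_D)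

lemma \<alpha>e_mult_e: "\<lbrakk>g \<in> carrier G; a \<in> carrier A\<rbrakk> \<Longrightarrow> \<alpha>e g a \<otimes>\<^bsub>A\<^esub> e g = \<alpha>e g a"
  by (metis e_central e_mult_\<alpha>e \<alpha>e_closed)

lemma \<alpha>e_mult:
  assumes "g \<in> carrier G" "a \<in> carrier A" "b \<in> carrier A"
  shows "\<alpha>e g (a \<otimes>\<^bsub>A\<^esub> b) = \<alpha>e g a \<otimes>\<^bsub>A\<^esub> \<alpha>e g b"
proof -
  let ?e = "e (inv\<^bsub>G\<^esub> g)"
  have ec: "?e \<in> carrier A"
    using assms by (simp add: e_closed)
  have "(?e \<otimes>\<^bsub>A\<^esub> a) \<otimes>\<^bsub>A\<^esub> (?e \<otimes>\<^bsub>A\<^esub> b) = (?e \<otimes>\<^bsub>A\<^esub> a \<otimes>\<^bsub>A\<^esub> ?e) \<otimes>\<^bsub>A\<^esub> b"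
    using assms ec by (simp add: m_assoc)
  also have "?e \<otimes>\<^bsub>A\<^esub> a \<otimes>\<^bsub>A\<^esub> ?e = ?e \<otimes>\<^bsub>A\<^esub> (?e \<otimes>\<^bsub>A\<^esub> a)"
    using assms ec e_central[of "inv\<^bsub>G\<^esub> g" "?e \<otimes>\<^bsub>A\<^esub> a"] by simp
  also have "\<dots> \<otimes>\<^bsub>A\<^esub> b = ?e \<otimes>\<^bsub>A\<^esub> (a \<otimes>\<^bsub>A\<^esub> b)"
    using assms ec by (simp add: e_idem flip: m_assoc)
  finally show ?thesis
    using assms \<alpha>_mult[of g "?e \<otimes>\<^bsub>A\<^esub> a" "?e \<otimes>\<^bsub>A\<^esub> b"] by (simp add: e_mult_in_D)
qed

lemma \<alpha>e_add: "\<lbrakk>g \<in> carrier G; a \<in> carrier A; b \<in> carrier A\<rbrakk>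
    \<Longrightarrow> \<alpha>e g (a \<oplus>\<^bsub>A\<^esub> b) = \<alpha>e g a \<oplus>\<^bsub>A\<^esub> \<alpha>e g b"
  by (simp add: e_closed r_distr \<alpha>_add e_mult_in_D)

lemma \<alpha>e_hom: "g \<in> carrier G \<Longrightarrow> \<alpha>e g \<in> hom (add_monoid A) (add_monoid A)"
  by (auto simp: hom_def \<alpha>e_closed \<alpha>e_add)

text \<open>The ideal at the neutral element is all of \<open>A\<close>, so its identity is that of
  \<open>A\<close>. Hence \<open>\<alpha>e\<close> is trivial there.\<close>

lemma e_one: "e \<one>\<^bsub>G\<^esub> = \<one>\<^bsub>A\<^esub>"
  using e_mult_D[of "\<one>\<^bsub>G\<^esub>" "\<one>\<^bsub>A\<^esub>"] by (simp add: D_one e_closed)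

lemma list_mult_closed:
  "\<lbrakk>set gs \<subseteq> carrier G\<rbrakk> \<Longrightarrow> list_mult G gs \<in> carrier G"
  by (induction gs) (auto simp: list_mult_def)

lemma tuple_unit_closed:
  assumes "gs \<in> tuples G n"
  shows "tuple_unit A G e gs \<in> carrier A"
proof -
  have A: "list_mult A xs \<in> carrier A" if "set xs \<subseteq> carrier A" for xs
    using that by (induction xs) (auto simp: list_mult_def)
  have "list_mult G (take i gs) \<in> carrier G" for i
    using assms by (intro list_mult_closed) (auto simp: tuples_def dest: in_set_takeD)
  then show ?thesis
    unfolding tuple_unit_def by (intro A) (auto simp: e_closed simp del: upt_Suc)
qed

end

section \<open>Translates of the embedded algebra, and coordinates in \<open>A\<close>\<close>

locale unital_enveloping_action =
  unital_partial_action K A G D \<alpha> e + enveloping_action K A G D \<alpha> B \<beta> \<phi>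
  for K (structure) and A (structure) and G (structure)
    and D :: "'g \<Rightarrow> 'a set" and \<alpha> :: "'g \<Rightarrow> 'a \<Rightarrow> 'a" and e :: "'g \<Rightarrow> 'a"
    and B (structure) and \<beta> :: "'g \<Rightarrow> 'b \<Rightarrow> 'b" and \<phi> :: "'a \<Rightarrow> 'b"

context unital_enveloping_action
begin

lemma \<phi>_closed: "a \<in> carrier A \<Longrightarrow> \<phi> a \<in> carrier B"
  using \<phi>_hom by (auto simp: algebra_hom_def hom_def)

lemma \<phi>_add: "\<lbrakk>a \<in> carrier A; b \<in> carrier A\<rbrakk> \<Longrightarrow> \<phi> (a \<oplus>\<^bsub>A\<^esub> b) = \<phi> a \<oplus>\<^bsub>B\<^esub> \<phi> b"
  using \<phi>_hom by (auto simp: algebra_hom_def hom_def)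

lemma \<phi>_mult: "\<lbrakk>a \<in> carrier A; b \<in> carrier A\<rbrakk> \<Longrightarrow> \<phi> (a \<otimes>\<^bsub>A\<^esub> b) = \<phi> a \<otimes>\<^bsub>B\<^esub> \<phi> b"
  using \<phi>_hom by (auto simp: algebra_hom_def hom_def)

lemma \<phi>_smult: "\<lbrakk>k \<in> carrier K; a \<in> carrier A\<rbrakk> \<Longrightarrow> \<phi> (k \<odot>\<^bsub>A\<^esub> a) = k \<odot>\<^bsub>B\<^esub> \<phi> a"
  using \<phi>_hom by (auto simp: algebra_hom_def)

lemma \<phi>_eq_iff: "\<lbrakk>a \<in> carrier A; b \<in> carrier A\<rbrakk> \<Longrightarrow> \<phi> a = \<phi> b \<longleftrightarrow> a = b"
  using \<phi>_inj by (auto dest: inj_onD)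

lemma \<phi>_ideal_left: "\<lbrakk>b \<in> carrier B; a \<in> carrier A\<rbrakk> \<Longrightarrow> b \<otimes>\<^bsub>B\<^esub> \<phi> a \<in> \<phi> ` carrier A"
  using algebra_ideal.ideal_l_closed[OF \<phi>_ideal] by blast

lemma \<phi>_ideal_right: "\<lbrakk>b \<in> carrier B; a \<in> carrier A\<rbrakk> \<Longrightarrow> \<phi> a \<otimes>\<^bsub>B\<^esub> b \<in> \<phi> ` carrier A"
  using algebra_ideal.ideal_r_closed[OF \<phi>_ideal] by blast

text \<open>The product lies in both ideals, hence in the image of \<open>D g\<close>, on which
  \<open>\<phi> (e g)\<close> acts as identity. Since \<open>\<phi> (e g)\<close> is itself a
  translate under \<open>\<beta> g\<close>, the product can be computed inside one translate, and
  equivariance finishes.\<close>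

lemma \<phi>_one_mult_\<beta>:
  assumes g: "g \<in> carrier G" and a: "a \<in> carrier A"
  shows "\<phi> \<one>\<^bsub>A\<^esub> \<otimes>\<^bsub>B\<^esub> \<beta> g (\<phi> a) = \<phi> (\<alpha>e g a)"
proof -
  let ?y = "\<phi> \<one>\<^bsub>A\<^esub> \<otimes>\<^bsub>B\<^esub> \<beta> g (\<phi> a)"
  have cl: "\<beta> g (\<phi> a) \<in> carrier B" "\<phi> \<one>\<^bsub>A\<^esub> \<in> carrier B"
    using g a by (simp_all add: glob.\<beta>_closed \<phi>_closed)
  \<comment> \<open>Pulling \<open>\<beta> g\<close> out leaves a product with
    \<open>\<phi> a\<close>, which lies in the ideal; so \<open>?y\<close> lies in the translate for
    \<open>g\<close>.\<close>
  have "?y = \<beta> g (\<beta> (inv\<^bsub>G\<^esub> g) (\<phi> \<one>\<^bsub>A\<^esub>) \<otimes>\<^bsub>B\<^esub> \<phi> a)"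
    using g a cl by (simp add: glob.\<beta>_mult glob.\<beta>_closed glob.\<beta>_inv_right \<phi>_closed)
  moreover have "\<beta> (inv\<^bsub>G\<^esub> g) (\<phi> \<one>\<^bsub>A\<^esub>) \<otimes>\<^bsub>B\<^esub> \<phi> a \<in> \<phi> ` carrier A"
    using g a cl by (intro \<phi>_ideal_left glob.\<beta>_closed) auto
  ultimately have "?y \<in> \<beta> g ` \<phi> ` carrier A"
    by blast
  moreover have "?y \<in> \<phi> ` carrier A"
    using cl by (intro \<phi>_ideal_right) auto
  ultimately obtain d where d: "d \<in> D g" "?y = \<phi> d"
    using \<phi>_D[OF g] by blast
  have dA: "d \<in> carrier A"
    using d D_subset g by blast
  have "?y = \<phi> (e g \<otimes>\<^bsub>A\<^esub> d)"
    using d g by (simp add: e_mult_D)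
  also have "\<dots> = \<phi> (e g) \<otimes>\<^bsub>B\<^esub> ?y"
    using d dA g by (simp add: \<phi>_mult e_closed)
  also have "\<dots> = \<phi> (e g) \<otimes>\<^bsub>B\<^esub> \<beta> g (\<phi> a)"
    using g a cl by (simp add: e_closed \<phi>_closed flip: glob.mult_assoc \<phi>_mult)
  also have "\<phi> (e g) = \<beta> g (\<phi> (e (inv\<^bsub>G\<^esub> g)))"
    using g \<phi>_equivariant[of g "e (inv\<^bsub>G\<^esub> g)"] by (simp add: \<alpha>_e e_in_D)
  also have "\<dots> \<otimes>\<^bsub>B\<^esub> \<beta> g (\<phi> a) = \<beta> g (\<phi> (e (inv\<^bsub>G\<^esub> g) \<otimes>\<^bsub>A\<^esub> a))"
    using g a by (simp add: e_closed \<phi>_closed glob.\<beta>_mult \<phi>_mult)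
  also have "\<dots> = \<phi> (\<alpha>e g a)"
    using g a by (simp add: \<phi>_equivariant e_mult_in_D)
  finally show ?thesis .
qed

text \<open>The generators are translated by the inverse of \<open>s\<close>, so that the component
  at \<open>s\<close> of the generator for \<open>a\<close> is \<open>a\<close> itself.\<close>

lemma B_induct [consumes 1, case_names zero add translate]:
  assumes "b \<in> carrier B"
    and zero: "P \<zero>\<^bsub>B\<^esub>"
    and add: "\<And>b c. \<lbrakk>b \<in> carrier B; c \<in> carrier B; P b; P c\<rbrakk> \<Longrightarrow> P (b \<oplus>\<^bsub>B\<^esub> c)"
    and translate: "\<And>s a. \<lbrakk>s \<in> carrier G; a \<in> carrier A\<rbrakk> \<Longrightarrow> P (\<beta> (inv\<^bsub>G\<^esub> s) (\<phi> a))"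
  shows "P b"
proof -
  from assms(1) obtain F x where b: "b = (\<Oplus>\<^bsub>B\<^esub>g\<in>F. x g)"
    and F: "finite F" "F \<subseteq> carrier G" "\<forall>g\<in>F. x g \<in> \<beta> g ` \<phi> ` carrier A"
    by (subst (asm) \<phi>_span) blast
  have "P (\<Oplus>\<^bsub>B\<^esub>g\<in>F. x g)"
    using F
  proof (induction F rule: finite_induct)
    case (insert g F)
    have xB: "x h \<in> carrier B" if "h \<in> insert g F" for h
    proof -
      have "x h \<in> \<beta> h ` \<phi> ` carrier A" "h \<in> carrier G"
        using insert.prems that by auto
      then show ?thesis
        by (auto intro!: glob.\<beta>_closed \<phi>_closed)
    qed
    obtain a where a: "a \<in> carrier A" "x g = \<beta> g (\<phi> a)"
      using insert.prems by blast
    have "P (x g)"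
      using translate[of "inv\<^bsub>G\<^esub> g" a] a insert.prems by simp
    then have "P (x g \<oplus>\<^bsub>B\<^esub> (\<Oplus>\<^bsub>B\<^esub>g\<in>F. x g))"
      using insert xB by (intro add glob.M.finsum_closed) auto
    then show ?case
      using insert.hyps xB by (subst glob.M.finsum_insert) auto
  qed (simp add: zero)
  with b show ?thesis by simp
qed

text \<open>Multiplication by \<open>\<phi> \<one>\<close> projects \<open>B\<close> onto the image
  of \<open>\<phi>\<close>, because this image is an ideal; hence \<open>inv_into\<close> has a
  preimage to return for arguments in the carriers.\<close>

definition component :: "'b \<Rightarrow> 'g \<Rightarrow> 'a"
  where "component b t = inv_into (carrier A) \<phi> (\<phi> \<one>\<^bsub>A\<^esub> \<otimes>\<^bsub>B\<^esub> \<beta> t b)"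

lemma component_closed:
  assumes "b \<in> carrier B" "t \<in> carrier G"
  shows "component b t \<in> carrier A"
  using assms unfolding component_def
  by (intro inv_into_into \<phi>_ideal_right glob.\<beta>_closed) auto

lemma \<phi>_component:
  assumes "b \<in> carrier B" "t \<in> carrier G"
  shows "\<phi> (component b t) = \<phi> \<one>\<^bsub>A\<^esub> \<otimes>\<^bsub>B\<^esub> \<beta> t b"
  using assms unfolding component_def
  by (intro f_inv_into_f \<phi>_ideal_right glob.\<beta>_closed) auto

lemma component_eqI:
  assumes "b \<in> carrier B" "t \<in> carrier G" "a \<in> carrier A" "\<phi> a = \<phi> \<one>\<^bsub>A\<^esub> \<otimes>\<^bsub>B\<^esub> \<beta> t b"
  shows "component b t = a"
  using assms \<phi>_component[of b t] component_closed[of b t] by (metis \<phi>_eq_iff)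

lemma component_add:
  assumes "b \<in> carrier B" "c \<in> carrier B" "t \<in> carrier G"
  shows "component (b \<oplus>\<^bsub>B\<^esub> c) t = component b t \<oplus>\<^bsub>A\<^esub> component c t"
  using assms
  by (intro component_eqI) (simp_all add: component_closed \<phi>_component \<phi>_add \<phi>_closed
      glob.\<beta>_add glob.\<beta>_closed glob.mult_r_distr)

lemma component_smult:
  assumes "k \<in> carrier K" "b \<in> carrier B" "t \<in> carrier G"
  shows "component (k \<odot>\<^bsub>B\<^esub> b) t = k \<odot>\<^bsub>A\<^esub> component b t"
  using assms
  by (intro component_eqI) (simp_all add: component_closed \<phi>_component \<phi>_smult \<phi>_closed
      glob.\<beta>_smult glob.\<beta>_closed glob.smult_mult_right)

text \<open>The factor \<open>\<phi> \<one>\<close> in front of the second translate is absorbed by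
  \<open>\<phi> (component b t)\<close>.\<close>

lemma component_mult:
  assumes "b \<in> carrier B" "c \<in> carrier B" "t \<in> carrier G"
  shows "component (b \<otimes>\<^bsub>B\<^esub> c) t = component b t \<otimes>\<^bsub>A\<^esub> component c t"
proof (rule component_eqI)
  have "\<phi> (component b t \<otimes>\<^bsub>A\<^esub> component c t)
      = \<phi> (component b t) \<otimes>\<^bsub>B\<^esub> (\<phi> \<one>\<^bsub>A\<^esub> \<otimes>\<^bsub>B\<^esub> \<beta> t c)"
    using assms by (simp add: \<phi>_mult component_closed \<phi>_component)
  also have "\<dots> = \<phi> (component b t) \<otimes>\<^bsub>B\<^esub> \<beta> t c"
    using assms
    by (simp add: component_closed \<phi>_closed glob.\<beta>_closed flip: glob.mult_assoc \<phi>_mult)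
  also have "\<dots> = \<phi> \<one>\<^bsub>A\<^esub> \<otimes>\<^bsub>B\<^esub> \<beta> t (b \<otimes>\<^bsub>B\<^esub> c)"
    using assms by (simp add: \<phi>_component \<phi>_closed glob.\<beta>_mult glob.\<beta>_closed glob.mult_assoc)
  finally show "\<phi> (component b t \<otimes>\<^bsub>A\<^esub> component c t) = \<phi> \<one>\<^bsub>A\<^esub> \<otimes>\<^bsub>B\<^esub> \<beta> t (b \<otimes>\<^bsub>B\<^esub> c)" .
qed (use assms in \<open>simp_all add: component_closed glob.mult_closed\<close>)

lemma component_\<beta>:
  assumes "b \<in> carrier B" "g \<in> carrier G" "t \<in> carrier G"
  shows "component (\<beta> g b) t = component b (t \<otimes>\<^bsub>G\<^esub> g)"
  using assms by (simp add: component_def glob.\<beta>_comp)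

text \<open>The two translations combine into one, and \<open>\<phi>_one_mult_\<beta>\<close>
  evaluates its projection.\<close>

lemma component_translate:
  assumes "s \<in> carrier G" "t \<in> carrier G" "a \<in> carrier A"
  shows "component (\<beta> (inv\<^bsub>G\<^esub> s) (\<phi> a)) t = \<alpha>e (t \<otimes>\<^bsub>G\<^esub> inv\<^bsub>G\<^esub> s) a"
  using assms
  by (intro component_eqI \<alpha>e_closed)
    (simp_all add: glob.\<beta>_closed \<phi>_closed glob.\<beta>_comp \<phi>_one_mult_\<beta>)

lemma component_hom:
  "t \<in> carrier G \<Longrightarrow> (\<lambda>b. component b t) \<in> hom (add_monoid B) (add_monoid A)"
  by (auto simp: hom_def component_closed component_add)

lemma component_zero: "t \<in> carrier G \<Longrightarrow> component \<zero>\<^bsub>B\<^esub> t = \<zero>\<^bsub>A\<^esub>"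
  using component_add[of "\<zero>\<^bsub>B\<^esub>" "\<zero>\<^bsub>B\<^esub>" t] component_closed[of "\<zero>\<^bsub>B\<^esub>" t] by simp

text \<open>The ideals \<open>\<beta>\<^sub>g(\<phi>(A))\<close> are unital, and if \<open>v\<close> and \<open>f\<close> act as left identities on two ideals, then
  \<open>v + f - v f\<close> does on their sum.\<close>

lemma finite_local_unit:
  assumes "finite F" "F \<subseteq> carrier G"
  shows "\<exists>v\<in>carrier B. \<forall>s\<in>F. \<forall>a\<in>carrier A.
    v \<otimes>\<^bsub>B\<^esub> \<beta> (inv\<^bsub>G\<^esub> s) (\<phi> a) = \<beta> (inv\<^bsub>G\<^esub> s) (\<phi> a)"
  using assms
proof (induction F rule: finite_induct)
  case empty
  show ?case by (intro bexI[of _ "\<zero>\<^bsub>B\<^esub>"]) auto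
next
  case (insert g F)
  then obtain v where v: "v \<in> carrier B" "\<And>s a. \<lbrakk>s \<in> F; a \<in> carrier A\<rbrakk>
      \<Longrightarrow> v \<otimes>\<^bsub>B\<^esub> \<beta> (inv\<^bsub>G\<^esub> s) (\<phi> a) = \<beta> (inv\<^bsub>G\<^esub> s) (\<phi> a)"
    by auto
  define f where "f = \<beta> (inv\<^bsub>G\<^esub> g) (\<phi> \<one>\<^bsub>A\<^esub>)"
  have g: "g \<in> carrier G"
    using insert by simp
  have f: "f \<in> carrier B"
    using g by (simp add: f_def glob.\<beta>_closed \<phi>_closed)
  let ?v = "v \<oplus>\<^bsub>B\<^esub> (f \<oplus>\<^bsub>B\<^esub> \<ominus>\<^bsub>B\<^esub> (v \<otimes>\<^bsub>B\<^esub> f))"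
  have dist: "?v \<otimes>\<^bsub>B\<^esub> y = v \<otimes>\<^bsub>B\<^esub> y \<oplus>\<^bsub>B\<^esub> (f \<otimes>\<^bsub>B\<^esub> y \<oplus>\<^bsub>B\<^esub> \<ominus>\<^bsub>B\<^esub> (v \<otimes>\<^bsub>B\<^esub> (f \<otimes>\<^bsub>B\<^esub> y)))"
    if "y \<in> carrier B" for y
    using that v f by (simp add: glob.mult_l_distr glob.mult_closed glob.mult_minus_left
        glob.mult_assoc)
  show ?case
  proof (intro bexI[of _ ?v] ballI)
    fix s a assume s: "s \<in> insert g F" and a: "a \<in> carrier A"
    let ?y = "\<beta> (inv\<^bsub>G\<^esub> s) (\<phi> a)"
    have sG: "s \<in> carrier G"
      using s insert by auto
    have y: "?y \<in> carrier B"
      using sG a by (simp add: glob.\<beta>_closed \<phi>_closed)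
    show "?v \<otimes>\<^bsub>B\<^esub> ?y = ?y"
    proof (cases "s = g")
      case True
      have "f \<otimes>\<^bsub>B\<^esub> ?y = ?y"
        unfolding f_def True using g a by (simp add: \<phi>_closed flip: glob.\<beta>_mult \<phi>_mult)
      then show ?thesis
        unfolding dist[OF y] using y v(1) by (simp add: glob.mult_closed glob.M.r_neg glob.M.a_lcomm)
    next
      case False
      \<comment> \<open>Multiplication by \<open>f\<close> stays in the translate for
        \<open>s\<close>, which is a left ideal. So \<open>v\<close> fixes this product too, and the
        last two terms of \<open>dist\<close> cancel.\<close>
      have "f \<otimes>\<^bsub>B\<^esub> ?y = \<beta> (inv\<^bsub>G\<^esub> s) (\<beta> s f \<otimes>\<^bsub>B\<^esub> \<phi> a)"
        using f sG a by (simp add: glob.\<beta>_mult glob.\<beta>_closed glob.\<beta>_inv_left \<phi>_closed)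
      moreover have "\<beta> s f \<otimes>\<^bsub>B\<^esub> \<phi> a \<in> \<phi> ` carrier A"
        using f sG a by (intro \<phi>_ideal_left glob.\<beta>_closed)
      ultimately obtain a' where "a' \<in> carrier A" "f \<otimes>\<^bsub>B\<^esub> ?y = \<beta> (inv\<^bsub>G\<^esub> s) (\<phi> a')"
        by auto
      with False s v(2) have "v \<otimes>\<^bsub>B\<^esub> (f \<otimes>\<^bsub>B\<^esub> ?y) = f \<otimes>\<^bsub>B\<^esub> ?y"
        by simp
      moreover have "v \<otimes>\<^bsub>B\<^esub> ?y = ?y"
        using False s v(2) a by simp
      ultimately show ?thesis
        unfolding dist[OF y] using y f by (simp add: glob.mult_closed glob.M.r_neg)
    qed
  qed (use v f in \<open>simp add: glob.mult_closed\<close>)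
qed

text \<open>Left units for \<open>b\<close> and \<open>c\<close> need not agree, so the induction
  collects a finite set \<open>F\<close> of translates instead: whatever acts as left identity on
  all of them fixes \<open>b\<close>. Unions of such sets handle sums.\<close>

lemma local_unit:
  assumes "b \<in> carrier B"
  obtains v where "v \<in> carrier B" "v \<otimes>\<^bsub>B\<^esub> b = b"
proof -
  have "\<exists>F. finite F \<and> F \<subseteq> carrier G \<and> (\<forall>v\<in>carrier B.
      (\<forall>s\<in>F. \<forall>a\<in>carrier A. v \<otimes>\<^bsub>B\<^esub> \<beta> (inv\<^bsub>G\<^esub> s) (\<phi> a) = \<beta> (inv\<^bsub>G\<^esub> s) (\<phi> a))
      \<longrightarrow> v \<otimes>\<^bsub>B\<^esub> b = b)"
    using assms
  proof (induction rule: B_induct)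
    case zero
    show ?case by (intro exI[of _ "{}"]) (simp add: glob.mult_zero_right)
  next
    case (add b c)
    then obtain F F' where "finite F" "F \<subseteq> carrier G" "finite F'" "F' \<subseteq> carrier G"
      and "\<And>v. \<lbrakk>v \<in> carrier B; \<forall>s\<in>F. \<forall>a\<in>carrier A.
        v \<otimes>\<^bsub>B\<^esub> \<beta> (inv\<^bsub>G\<^esub> s) (\<phi> a) = \<beta> (inv\<^bsub>G\<^esub> s) (\<phi> a)\<rbrakk> \<Longrightarrow> v \<otimes>\<^bsub>B\<^esub> b = b"
      and "\<And>v. \<lbrakk>v \<in> carrier B; \<forall>s\<in>F'. \<forall>a\<in>carrier A.
        v \<otimes>\<^bsub>B\<^esub> \<beta> (inv\<^bsub>G\<^esub> s) (\<phi> a) = \<beta> (inv\<^bsub>G\<^esub> s) (\<phi> a)\<rbrakk> \<Longrightarrow> v \<otimes>\<^bsub>B\<^esub> c = c"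
      by metis
    with add.hyps show ?case
      by (intro exI[of _ "F \<union> F'"]) (simp add: glob.mult_r_distr)
  next
    case (translate s a)
    then show ?case by (intro exI[of _ "{s}"]) simp
  qed
  then show thesis
    using finite_local_unit that by metis
qed

text \<open>Multiplying by a generator from the left depends on one component only, so
  \<open>b\<close> and \<open>c\<close> have the same left multiples. A left unit for the difference
  \<open>d\<close> then forces it to vanish; it replaces an identity of \<open>B\<close>.\<close>

lemma component_inject:
  assumes b: "b \<in> carrier B" and c: "c \<in> carrier B"
    and eq: "\<And>t. t \<in> carrier G \<Longrightarrow> component b t = component c t"
  shows "b = c"
proof -
  have gen: "\<beta> (inv\<^bsub>G\<^esub> s) (\<phi> a) \<otimes>\<^bsub>B\<^esub> b = \<beta> (inv\<^bsub>G\<^esub> s) (\<phi> a) \<otimes>\<^bsub>B\<^esub> c"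
    if s: "s \<in> carrier G" and a: "a \<in> carrier A" for s a
  proof -
    \<comment> \<open>The product sees nothing of \<open>x\<close> but its component at
      \<open>s\<close>.\<close>
    have "\<beta> (inv\<^bsub>G\<^esub> s) (\<phi> a) \<otimes>\<^bsub>B\<^esub> x = \<beta> (inv\<^bsub>G\<^esub> s) (\<phi> (a \<otimes>\<^bsub>A\<^esub> component x s))"
      if x: "x \<in> carrier B" for x
    proof -
      have "\<phi> (a \<otimes>\<^bsub>A\<^esub> component x s) = \<phi> a \<otimes>\<^bsub>B\<^esub> \<beta> s x"
        using s a x by (simp add: \<phi>_mult component_closed \<phi>_component)
          (simp add: \<phi>_closed glob.\<beta>_closed flip: glob.mult_assoc \<phi>_mult)
      then show ?thesis
        using s a x by (simp add: glob.\<beta>_mult glob.\<beta>_closed glob.\<beta>_inv_left \<phi>_closed)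
    qed
    then show ?thesis
      using b c s eq by simp
  qed
  have cancel: "x \<otimes>\<^bsub>B\<^esub> b = x \<otimes>\<^bsub>B\<^esub> c" if "x \<in> carrier B" for x
    using that
  proof (induction rule: B_induct)
    case zero
    then show ?case using b c by (simp add: glob.mult_zero_left)
  next
    case (add x y)
    then show ?case using b c by (simp add: glob.mult_l_distr)
  next
    case (translate s a)
    then show ?case by (rule gen)
  qed
  define d where "d = b \<oplus>\<^bsub>B\<^esub> \<ominus>\<^bsub>B\<^esub> c"
  have d: "d \<in> carrier B"
    using b c by (simp add: d_def)
  then obtain v where v: "v \<in> carrier B" "v \<otimes>\<^bsub>B\<^esub> d = d"
    by (rule local_unit)
  have "v \<otimes>\<^bsub>B\<^esub> d = \<zero>\<^bsub>B\<^esub>"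
    using b c v(1) cancel[OF v(1)]
    by (simp add: d_def glob.mult_r_distr glob.mult_minus_right glob.mult_closed glob.M.r_neg)
  with v have "b \<oplus>\<^bsub>B\<^esub> \<ominus>\<^bsub>B\<^esub> c = \<zero>\<^bsub>B\<^esub>"
    by (simp add: d_def)
  with b c show ?thesis
    by (metis glob.M.add.inv_closed glob.M.minus_equality glob.M.minus_minus)
qed

end

section \<open>Multipliers from compatible families and globalization\<close>

context unital_enveloping_action
begin

definition compatible :: "('g \<Rightarrow> 'a) \<Rightarrow> bool"
  where "compatible c \<longleftrightarrow> c \<in> carrier G \<rightarrow> carrier A \<and>
    (\<forall>x\<in>carrier G. \<forall>s\<in>carrier G. \<alpha>e x (c s) = e x \<otimes>\<^bsub>A\<^esub> c (x \<otimes>\<^bsub>G\<^esub> s))"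

text \<open>The defining identity at the element for which \<open>component_translate\<close>
  evaluates \<open>\<alpha>e\<close>.\<close>

lemma compatible_translate:
  assumes "compatible c" "s \<in> carrier G" "t \<in> carrier G"
  shows "\<alpha>e (t \<otimes>\<^bsub>G\<^esub> inv\<^bsub>G\<^esub> s) (c s) = e (t \<otimes>\<^bsub>G\<^esub> inv\<^bsub>G\<^esub> s) \<otimes>\<^bsub>A\<^esub> c t"
  using assms by (simp add: compatible_def G.m_assoc)

lemma compatible_closed: "\<lbrakk>compatible c; t \<in> carrier G\<rbrakk> \<Longrightarrow> c t \<in> carrier A"
  by (auto simp: compatible_def)

text \<open>Multiplying all components of a translate by \<open>c\<close> gives a translate again.
  The idempotent that compatibility introduces is absorbed by \<open>\<alpha>e\<close>.\<close>

lemma component_translate_right: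
  assumes c: "compatible c" and st: "s \<in> carrier G" "t \<in> carrier G" and a: "a \<in> carrier A"
  shows "component (\<beta> (inv\<^bsub>G\<^esub> s) (\<phi> (a \<otimes>\<^bsub>A\<^esub> c s))) t
    = component (\<beta> (inv\<^bsub>G\<^esub> s) (\<phi> a)) t \<otimes>\<^bsub>A\<^esub> c t"
proof -
  let ?x = "t \<otimes>\<^bsub>G\<^esub> inv\<^bsub>G\<^esub> s"
  have x: "?x \<in> carrier G"
    using st by simp
  have "\<alpha>e ?x (a \<otimes>\<^bsub>A\<^esub> c s) = \<alpha>e ?x a \<otimes>\<^bsub>A\<^esub> (e ?x \<otimes>\<^bsub>A\<^esub> c t)"
    using \<alpha>e_mult[OF x a compatible_closed[OF c st(1)]] compatible_translate[OF c st] by simp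
  also have "\<dots> = \<alpha>e ?x a \<otimes>\<^bsub>A\<^esub> e ?x \<otimes>\<^bsub>A\<^esub> c t"
    using \<alpha>e_closed[OF x a] e_closed[OF x] compatible_closed[OF c st(2)] by (rule m_assoc[symmetric])
  also have "\<dots> = \<alpha>e ?x a \<otimes>\<^bsub>A\<^esub> c t"
    using \<alpha>e_mult_e[OF x a] by simp
  finally show ?thesis
    using component_translate[OF st a]
      component_translate[OF st m_closed[OF a compatible_closed[OF c st(1)]]] by simp
qed

text \<open>Here centrality first moves the idempotent next to \<open>\<alpha>e\<close>, where it is
  absorbed.\<close>

lemma component_translate_left:
  assumes c: "compatible c" and st: "s \<in> carrier G" "t \<in> carrier G" and a: "a \<in> carrier A"
  shows "component (\<beta> (inv\<^bsub>G\<^esub> s) (\<phi> (c s \<otimes>\<^bsub>A\<^esub> a))) t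
    = c t \<otimes>\<^bsub>A\<^esub> component (\<beta> (inv\<^bsub>G\<^esub> s) (\<phi> a)) t"
proof -
  let ?x = "t \<otimes>\<^bsub>G\<^esub> inv\<^bsub>G\<^esub> s"
  have x: "?x \<in> carrier G"
    using st by simp
  have "\<alpha>e ?x (c s \<otimes>\<^bsub>A\<^esub> a) = (e ?x \<otimes>\<^bsub>A\<^esub> c t) \<otimes>\<^bsub>A\<^esub> \<alpha>e ?x a"
    using \<alpha>e_mult[OF x compatible_closed[OF c st(1)] a] compatible_translate[OF c st] by simp
  also have "e ?x \<otimes>\<^bsub>A\<^esub> c t = c t \<otimes>\<^bsub>A\<^esub> e ?x"
    using x compatible_closed[OF c st(2)] by (rule e_central)
  also have "\<dots> \<otimes>\<^bsub>A\<^esub> \<alpha>e ?x a = c t \<otimes>\<^bsub>A\<^esub> (e ?x \<otimes>\<^bsub>A\<^esub> \<alpha>e ?x a)"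
    using compatible_closed[OF c st(2)] e_closed[OF x] \<alpha>e_closed[OF x a] by (rule m_assoc)
  also have "\<dots> = c t \<otimes>\<^bsub>A\<^esub> \<alpha>e ?x a"
    using e_mult_\<alpha>e[OF x a] by simp
  finally show ?thesis
    using component_translate[OF st a]
      component_translate[OF st m_closed[OF compatible_closed[OF c st(1)] a]] by simp
qed

text \<open>Componentwise multiplication by \<open>c\<close> does not leave \<open>B\<close>:
  generators go to generators, and sums follow by additivity.\<close>

lemma ex_component_right:
  assumes c: "compatible c" and "b \<in> carrier B"
  shows "\<exists>b'\<in>carrier B. \<forall>t\<in>carrier G. component b' t = component b t \<otimes>\<^bsub>A\<^esub> c t"
  using assms(2)
proof (induction rule: B_induct)
  case zero
  show ?case
    by (intro bexI[of _ "\<zero>\<^bsub>B\<^esub>"]) (auto simp: component_zero compatible_closed[OF c])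
next
  case (add b d)
  then obtain b' d' where "b' \<in> carrier B" "d' \<in> carrier B"
    "\<forall>t\<in>carrier G. component b' t = component b t \<otimes>\<^bsub>A\<^esub> c t"
    "\<forall>t\<in>carrier G. component d' t = component d t \<otimes>\<^bsub>A\<^esub> c t"
    by auto
  with add.hyps show ?case
    by (intro bexI[of _ "b' \<oplus>\<^bsub>B\<^esub> d'"])
      (auto simp: component_add l_distr component_closed compatible_closed[OF c])
next
  case (translate s a)
  then show ?case
    by (intro bexI[of _ "\<beta> (inv\<^bsub>G\<^esub> s) (\<phi> (a \<otimes>\<^bsub>A\<^esub> c s))"])
      (auto simp: component_translate_right[OF c] glob.\<beta>_closed \<phi>_closed compatible_closed[OF c])
qed

lemma ex_component_left:
  assumes c: "compatible c" and "b \<in> carrier B"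
  shows "\<exists>b'\<in>carrier B. \<forall>t\<in>carrier G. component b' t = c t \<otimes>\<^bsub>A\<^esub> component b t"
  using assms(2)
proof (induction rule: B_induct)
  case zero
  show ?case
    by (intro bexI[of _ "\<zero>\<^bsub>B\<^esub>"]) (auto simp: component_zero compatible_closed[OF c])
next
  case (add b d)
  then obtain b' d' where "b' \<in> carrier B" "d' \<in> carrier B"
    "\<forall>t\<in>carrier G. component b' t = c t \<otimes>\<^bsub>A\<^esub> component b t"
    "\<forall>t\<in>carrier G. component d' t = c t \<otimes>\<^bsub>A\<^esub> component d t"
    by auto
  with add.hyps show ?case
    by (intro bexI[of _ "b' \<oplus>\<^bsub>B\<^esub> d'"])
      (auto simp: component_add r_distr component_closed compatible_closed[OF c])
next
  case (translate s a)
  then show ?case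
    by (intro bexI[of _ "\<beta> (inv\<^bsub>G\<^esub> s) (\<phi> (c s \<otimes>\<^bsub>A\<^esub> a))"])
      (auto simp: component_translate_left[OF c] glob.\<beta>_closed \<phi>_closed compatible_closed[OF c])
qed

text \<open>For compatible \<open>c\<close> there is exactly one candidate for each choice: it
  exists by \<open>ex_component_right\<close> and \<open>ex_component_left\<close>, and it is unique
  by \<open>component_inject\<close>. Right multiplication commutes with left multiplication, which
  is why it is the first half.\<close>

definition multiplier_of :: "('g \<Rightarrow> 'a) \<Rightarrow> ('b \<Rightarrow> 'b) \<times> ('b \<Rightarrow> 'b)"
  where "multiplier_of c =
    (\<lambda>b\<in>carrier B. SOME b'. b' \<in> carrier B \<and>
        (\<forall>t\<in>carrier G. component b' t = component b t \<otimes>\<^bsub>A\<^esub> c t),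
     \<lambda>b\<in>carrier B. SOME b'. b' \<in> carrier B \<and>
        (\<forall>t\<in>carrier G. component b' t = c t \<otimes>\<^bsub>A\<^esub> component b t))"

lemma
  assumes "compatible c" "b \<in> carrier B"
  shows fst_multiplier_of_closed: "fst (multiplier_of c) b \<in> carrier B"
    and component_fst_multiplier_of: "t \<in> carrier G \<Longrightarrow>
      component (fst (multiplier_of c) b) t = component b t \<otimes>\<^bsub>A\<^esub> c t"
  using someI_ex[OF ex_component_right[OF assms, unfolded Bex_def]] assms(2)
  by (auto simp: multiplier_of_def)

lemma
  assumes "compatible c" "b \<in> carrier B"
  shows snd_multiplier_of_closed: "snd (multiplier_of c) b \<in> carrier B"
    and component_snd_multiplier_of: "t \<in> carrier G \<Longrightarrow>
      component (snd (multiplier_of c) b) t = c t \<otimes>\<^bsub>A\<^esub> component b t"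
  using someI_ex[OF ex_component_left[OF assms, unfolded Bex_def]] assms(2)
  by (auto simp: multiplier_of_def)

text \<open>Every law is an equation in \<open>B\<close>, so it may be tested on components, where
  it becomes distributivity, associativity or a scalar law in \<open>A\<close>.\<close>

lemma multiplier_of_closed:
  assumes c: "compatible c"
  shows "multiplier_of c \<in> carrier (multiplier_algebra K B)"
proof -
  note closed = fst_multiplier_of_closed[OF c] snd_multiplier_of_closed[OF c]
    component_closed compatible_closed[OF c]
  note comp = component_fst_multiplier_of[OF c] component_snd_multiplier_of[OF c]
    component_add component_mult component_smult
  have "fst (multiplier_of c) \<in> left_module_endos K B"
    unfolding left_module_endos_def mem_Collect_eq
  proof (intro conjI ballI)
    show "fst (multiplier_of c) \<in> carrier B \<rightarrow>\<^sub>E carrier B"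
      using closed by (auto simp: multiplier_of_def)
  qed (rule component_inject; simp add: closed comp l_distr m_assoc smult_mult_left
      glob.mult_closed)+
  moreover have "snd (multiplier_of c) \<in> right_module_endos K B"
    unfolding right_module_endos_def mem_Collect_eq
  proof (intro conjI ballI)
    show "snd (multiplier_of c) \<in> carrier B \<rightarrow>\<^sub>E carrier B"
      using closed by (auto simp: multiplier_of_def)
  qed (rule component_inject; simp add: closed comp r_distr m_assoc smult_mult_right
      glob.mult_closed)+
  moreover have "fst (multiplier_of c) a \<otimes>\<^bsub>B\<^esub> b = a \<otimes>\<^bsub>B\<^esub> snd (multiplier_of c) b"
    if "a \<in> carrier B" "b \<in> carrier B" for a b
    using that by (intro component_inject) (simp_all add: closed comp m_assoc glob.mult_closed)
  ultimately show ?thesis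
    by (simp add: glob.multiplier_carrier_iff)
qed

text \<open>An element of the image of \<open>\<phi>\<close> is its own translate at the neutral
  element, so \<open>component_translate_right\<close> applies there.\<close>

lemma multiplier_of_\<phi>:
  assumes "compatible c" "a \<in> carrier A"
  shows "fst (multiplier_of c) (\<phi> a) = \<phi> (a \<otimes>\<^bsub>A\<^esub> c \<one>\<^bsub>G\<^esub>)"
proof (rule component_inject)
  fix t assume t: "t \<in> carrier G"
  show "component (fst (multiplier_of c) (\<phi> a)) t = component (\<phi> (a \<otimes>\<^bsub>A\<^esub> c \<one>\<^bsub>G\<^esub>)) t"
    using component_translate_right[OF assms(1) _ t assms(2), of "\<one>\<^bsub>G\<^esub>"] assms t
    by (simp add: component_fst_multiplier_of \<phi>_closed compatible_closed glob.\<beta>_one)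
qed (use assms in \<open>simp_all add: fst_multiplier_of_closed compatible_closed \<phi>_closed\<close>)

section \<open>Truncated cocycles\<close>

sublocale A_coeff: group_coefficients G A
  by (intro group_coefficients.intro G.is_group M.abelian_group_axioms)

sublocale B_coeff: group_coefficients G B
  by (intro group_coefficients.intro G.is_group glob.M.abelian_group_axioms)

sublocale M_coeff: group_coefficients G "multiplier_algebra K B"
  by (intro group_coefficients.intro G.is_group glob.abelian_group_multiplier_algebra)

lemma left_mult_tail_coboundary:
  assumes "a \<in> carrier A" "gs \<in> tuples G (Suc n)" "f \<in> tuples G n \<rightarrow> carrier A"
  shows "a \<otimes>\<^bsub>A\<^esub> tail_coboundary G A f gs = tail_coboundary G A (\<lambda>hs. a \<otimes>\<^bsub>A\<^esub> f hs) gs"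
  using assms
  by (intro tail_coboundary_hom[where h = "\<lambda>y. a \<otimes>\<^bsub>A\<^esub> y" and M = A and N = A and n = n]
      A_coeff.group_coefficients_axioms) (auto simp: hom_def r_distr)

lemma right_mult_tail_coboundary:
  assumes "a \<in> carrier A" "gs \<in> tuples G (Suc n)" "f \<in> tuples G n \<rightarrow> carrier A"
  shows "tail_coboundary G A f gs \<otimes>\<^bsub>A\<^esub> a = tail_coboundary G A (\<lambda>hs. f hs \<otimes>\<^bsub>A\<^esub> a) gs"
  using assms
  by (intro tail_coboundary_hom[where h = "\<lambda>y. y \<otimes>\<^bsub>A\<^esub> a" and M = A and N = A and n = n]
      A_coeff.group_coefficients_axioms) (auto simp: hom_def l_distr)

lemma minus_tail_coboundary:
  assumes "gs \<in> tuples G (Suc n)" "f \<in> tuples G n \<rightarrow> carrier A"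
  shows "\<ominus>\<^bsub>A\<^esub> tail_coboundary G A f gs = tail_coboundary G A (\<lambda>hs. \<ominus>\<^bsub>A\<^esub> f hs) gs"
  using assms
  by (intro tail_coboundary_hom[where h = "\<lambda>y. \<ominus>\<^bsub>A\<^esub> y" and M = A and N = A and n = n]
      A_coeff.group_coefficients_axioms) (auto simp: hom_def M.minus_add)

text \<open>The identity required of \<open>w'\<close> in the theorem.\<close>

definition truncated_cocycle :: "nat \<Rightarrow> ('g list \<Rightarrow> 'a) \<Rightarrow> bool"
  where "truncated_cocycle n f \<longleftrightarrow> f \<in> tuples G n \<rightarrow> carrier A \<and>
    (\<forall>g\<in>carrier G. \<forall>gs\<in>tuples G n.
      \<alpha>e g (f gs) \<oplus>\<^bsub>A\<^esub> e g \<otimes>\<^bsub>A\<^esub> tail_coboundary G A f (g # gs) = \<zero>\<^bsub>A\<^esub>)"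

text \<open>The alternating sum and the last term all carry the same idempotent
  \<open>e (hd gs)\<close>, unlike in \<open>par_coboundary\<close>, so it factors out and leaves
  \<open>tail_coboundary\<close>.\<close>

lemma truncated_cocycle_iff:
  assumes f: "f \<in> tuples G n \<rightarrow> carrier A"
  shows "truncated_cocycle n f \<longleftrightarrow> (\<forall>gs\<in>tuples G (n + 1).
    \<alpha> (hd gs) (e (inv\<^bsub>G\<^esub> (hd gs)) \<otimes>\<^bsub>A\<^esub> f (tl gs))
    \<oplus>\<^bsub>A\<^esub> (\<Oplus>\<^bsub>A\<^esub>i\<in>{1..n}. [((-1::int) ^ i)] \<cdot>\<^bsub>A\<^esub> (e (hd gs) \<otimes>\<^bsub>A\<^esub> f (merge G i gs)))
    \<oplus>\<^bsub>A\<^esub> [((-1::int) ^ (n + 1))] \<cdot>\<^bsub>A\<^esub> (e (hd gs) \<otimes>\<^bsub>A\<^esub> f (butlast gs)) = \<zero>\<^bsub>A\<^esub>)"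
    (is "_ \<longleftrightarrow> (\<forall>gs\<in>_. ?c gs = _)")
proof -
  have eq: "?c (g # gs) = \<alpha>e g (f gs) \<oplus>\<^bsub>A\<^esub> e g \<otimes>\<^bsub>A\<^esub> tail_coboundary G A f (g # gs)"
    if g: "g \<in> carrier G" and gs: "gs \<in> tuples G n" for g gs
  proof -
    have ggs: "g # gs \<in> tuples G (Suc n)"
      using g gs by simp
    have ef: "(\<lambda>hs. e g \<otimes>\<^bsub>A\<^esub> f hs) \<in> tuples G n \<rightarrow> carrier A"
      using f g by (auto simp: e_closed)
    have "butlast (g # gs) \<in> tuples G n"
      using ggs by (auto simp: tuples_def dest: in_set_butlastD)
    then have "e g \<otimes>\<^bsub>A\<^esub> f (butlast (g # gs)) \<in> carrier A"
      using ef by blast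
    moreover have "(\<lambda>i. [((-1::int) ^ i)] \<cdot>\<^bsub>A\<^esub> (e g \<otimes>\<^bsub>A\<^esub> f (merge G i (g # gs))))
        \<in> {1..n} \<rightarrow> carrier A"
      using ef A_coeff.merge_closed[OF ggs] by (intro Pi_I M.add.int_pow_closed) blast
    moreover have "\<alpha>e g (f gs) \<in> carrier A"
      using f g gs by (intro \<alpha>e_closed) auto
    moreover have "e g \<otimes>\<^bsub>A\<^esub> tail_coboundary G A f (g # gs)
        = tail_coboundary G A (\<lambda>hs. e g \<otimes>\<^bsub>A\<^esub> f hs) (g # gs)"
      using g by (intro left_mult_tail_coboundary[OF _ ggs f] e_closed)
    ultimately show ?thesis
      by (simp only: list.sel A_coeff.tail_coboundary_eq_sum[OF ggs ef])
        (rule M.a_assoc; simp add: M.finsum_closed M.add.int_pow_closed)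
  qed
  show ?thesis
  proof
    assume *: "truncated_cocycle n f"
    show "\<forall>gs\<in>tuples G (n + 1). ?c gs = \<zero>\<^bsub>A\<^esub>"
    proof
      fix gs assume "gs \<in> tuples G (n + 1)"
      then obtain h hs where gs: "gs = h # hs" and "h \<in> carrier G" "hs \<in> tuples G n"
        by (auto elim: tuples_SucE)
      with * eq[of h hs] show "?c gs = \<zero>\<^bsub>A\<^esub>"
        unfolding gs truncated_cocycle_def by simp
    qed
  next
    assume *: "\<forall>gs\<in>tuples G (n + 1). ?c gs = \<zero>\<^bsub>A\<^esub>"
    show "truncated_cocycle n f"
      unfolding truncated_cocycle_def
    proof (intro conjI ballI f)
      fix h hs assume h: "h \<in> carrier G" "hs \<in> tuples G n"
      then have "?c (h # hs) = \<zero>\<^bsub>A\<^esub>"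
        by (intro bspec[OF *]) simp
      with eq[OF h] show "\<alpha>e h (f hs) \<oplus>\<^bsub>A\<^esub> e h \<otimes>\<^bsub>A\<^esub> tail_coboundary G A f (h # hs) = \<zero>\<^bsub>A\<^esub>"
        by simp
    qed
  qed
qed

section \<open>Passing from multiplier cocycles to truncated cocycles and back\<close>

lemma truncated_cocycle_of_multiplier_cocycle:
  assumes u: "u \<in> cocycles G (multiplier_algebra K B) (multiplier_action G B \<beta>) n"
    and f: "f \<in> tuples G n \<rightarrow> carrier A"
    and uf: "\<And>gs. gs \<in> tuples G n \<Longrightarrow> \<phi> (f gs) = fst (u gs) (\<phi> \<one>\<^bsub>A\<^esub>)"
  shows "truncated_cocycle n f"
  unfolding truncated_cocycle_def
proof (intro conjI ballI f)
  fix g gs assume g: "g \<in> carrier G" and gs: "gs \<in> tuples G n"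
  have ggs: "g # gs \<in> tuples G (Suc n)"
    using g gs by simp
  have uM: "u \<in> tuples G n \<rightarrow> carrier (multiplier_algebra K B)"
    using u by (simp add: cocycles_def)
  \<comment> \<open>A left module map is determined on the ideal by its value at
    \<open>\<phi> \<one>\<close>.\<close>
  have mult: "fst (u hs) (\<phi> a) = \<phi> (a \<otimes>\<^bsub>A\<^esub> f hs)" if "a \<in> carrier A" "hs \<in> tuples G n" for a hs
  proof -
    have "fst (u hs) \<in> left_module_endos K B"
      using uM that by (auto simp: glob.multiplier_carrier_iff)
    then have "fst (u hs) (\<phi> a \<otimes>\<^bsub>B\<^esub> \<phi> \<one>\<^bsub>A\<^esub>) = \<phi> a \<otimes>\<^bsub>B\<^esub> fst (u hs) (\<phi> \<one>\<^bsub>A\<^esub>)"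
      using that \<phi>_closed by (simp add: left_module_endos_def)
    moreover have "f hs \<in> carrier A"
      using f that by blast
    ultimately show ?thesis
      using that by (simp add: uf[symmetric] flip: \<phi>_mult)
  qed
  let ?act = "multiplier_action G B \<beta> g (u gs)"
    and ?tail = "tail_coboundary G (multiplier_algebra K B) u (g # gs)"
  \<comment> \<open>The cocycle identity is evaluated at this element. The inverse translation
    carries it to \<open>\<phi>\<close> of an idempotent, so the conjugated multiplier is applied
    inside the image of \<open>\<phi>\<close>, where \<open>mult\<close> describes it.\<close>
  let ?b = "\<phi> (e g)"
  have b: "?b \<in> carrier B"
    using g by (simp add: \<phi>_closed e_closed)
  have fgs: "f gs \<in> carrier A"
    using f gs by blast
  have act: "?act \<in> carrier (multiplier_algebra K B)"
    using uM g gs by (intro glob.multiplier_action_closed) auto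
  have tail: "?tail \<in> carrier (multiplier_algebra K B)"
    using ggs uM by (rule M_coeff.tail_coboundary_closed)
  have "?act \<oplus>\<^bsub>multiplier_algebra K B\<^esub> ?tail = \<zero>\<^bsub>multiplier_algebra K B\<^esub>"
    using u glob.coboundary_eq_tail[OF uM ggs] ggs by (simp add: cocycles_def)
  then have "fst ?act ?b \<oplus>\<^bsub>B\<^esub> fst ?tail ?b = \<zero>\<^bsub>B\<^esub>"
    using b act tail by (simp add: glob.multiplier_add glob.multiplier_zero fun_eq_iff restrict_def)
      metis
  moreover have "fst ?act ?b = \<phi> (\<alpha>e g (f gs))"
  proof -
    have "\<beta> (inv\<^bsub>G\<^esub> g) ?b = \<phi> (e (inv\<^bsub>G\<^esub> g))"
      using g \<phi>_equivariant[of "inv\<^bsub>G\<^esub> g" "e g"] \<alpha>_e[of "inv\<^bsub>G\<^esub> g"] by (simp add: e_in_D)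
    then have "fst ?act ?b = \<beta> g (\<phi> (e (inv\<^bsub>G\<^esub> g) \<otimes>\<^bsub>A\<^esub> f gs))"
      using b g gs by (simp add: multiplier_action_def split_beta mult e_closed)
    also have "\<dots> = \<phi> (\<alpha>e g (f gs))"
      using g fgs by (simp add: \<phi>_equivariant e_mult_in_D)
    finally show ?thesis .
  qed
  moreover have "fst ?tail ?b = \<phi> (e g \<otimes>\<^bsub>A\<^esub> tail_coboundary G A f (g # gs))"
  proof -
    have "fst ?tail ?b = tail_coboundary G B (\<lambda>hs. fst (u hs) ?b) (g # gs)"
      using b ggs uM
      by (intro tail_coboundary_hom[where n = n and h = "\<lambda>\<gamma>. fst \<gamma> ?b"]
          glob.multiplier_fst_hom M_coeff.group_coefficients_axioms
          B_coeff.group_coefficients_axioms)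
    also have "\<dots> = tail_coboundary G B (\<lambda>hs. \<phi> (e g \<otimes>\<^bsub>A\<^esub> f hs)) (g # gs)"
      using g by (intro B_coeff.tail_coboundary_cong[OF ggs]) (simp add: mult e_closed)
    also have "\<dots> = \<phi> (tail_coboundary G A (\<lambda>hs. e g \<otimes>\<^bsub>A\<^esub> f hs) (g # gs))"
      using ggs f g \<phi>_hom
      by (intro tail_coboundary_hom[where n = n and h = \<phi>, symmetric]
          A_coeff.group_coefficients_axioms B_coeff.group_coefficients_axioms)
        (auto simp: algebra_hom_def e_closed)
    also have "\<dots> = \<phi> (e g \<otimes>\<^bsub>A\<^esub> tail_coboundary G A f (g # gs))"
      using ggs f g by (simp add: left_mult_tail_coboundary[where n = n] e_closed)
    finally show ?thesis .
  qed
  moreover have "\<alpha>e g (f gs) \<in> carrier A" "tail_coboundary G A f (g # gs) \<in> carrier A"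
    using g fgs A_coeff.tail_coboundary_closed[OF ggs f] by (simp_all add: \<alpha>e_closed)
  ultimately have "\<phi> (\<alpha>e g (f gs) \<oplus>\<^bsub>A\<^esub> e g \<otimes>\<^bsub>A\<^esub> tail_coboundary G A f (g # gs)) = \<phi> \<zero>\<^bsub>A\<^esub>"
    using g \<phi>_add[of "\<zero>\<^bsub>A\<^esub>" "\<zero>\<^bsub>A\<^esub>"] \<phi>_closed[of "\<zero>\<^bsub>A\<^esub>"] by (simp add: \<phi>_add e_closed)
  then show "\<alpha>e g (f gs) \<oplus>\<^bsub>A\<^esub> e g \<otimes>\<^bsub>A\<^esub> tail_coboundary G A f (g # gs) = \<zero>\<^bsub>A\<^esub>"
    using \<open>\<alpha>e g (f gs) \<in> carrier A\<close> \<open>tail_coboundary G A f (g # gs) \<in> carrier A\<close> g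
    by (subst (asm) \<phi>_eq_iff) (simp_all add: e_closed)
qed

text \<open>The truncated identity turns \<open>\<alpha>e x\<close> of the negative of
  \<open>f\<close> into \<open>e x\<close> times the coboundary with first entry \<open>x\<close>.
  Used under the coboundary at \<open>s # gs\<close>, it leaves \<open>e x\<close> times an iterated
  coboundary, which \<open>tail_coboundary_square\<close> collapses to one with first entry
  \<open>x \<otimes> s\<close>.\<close>

lemma compatible_tail_coboundary:
  assumes f: "truncated_cocycle n f" and gs: "gs \<in> tuples G n"
  shows "compatible (\<lambda>t. \<ominus>\<^bsub>A\<^esub> tail_coboundary G A f (t # gs))"
  unfolding compatible_def
proof (intro conjI ballI)
  have fA: "f \<in> tuples G n \<rightarrow> carrier A"
    using f by (simp add: truncated_cocycle_def)
  have cl: "tail_coboundary G A f (t # hs) \<in> carrier A"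
    if "t \<in> carrier G" "hs \<in> tuples G n" for t hs
    using that fA by (intro A_coeff.tail_coboundary_closed) auto
  then show "(\<lambda>t. \<ominus>\<^bsub>A\<^esub> tail_coboundary G A f (t # gs)) \<in> carrier G \<rightarrow> carrier A"
    using gs by auto
  fix x s assume x: "x \<in> carrier G" and s: "s \<in> carrier G"
  have sgs: "s # gs \<in> tuples G (Suc n)"
    using s gs by simp
  let ?T = "tail_coboundary G A (\<lambda>hs. tail_coboundary G A f (x # hs)) (s # gs)"
  have T: "?T \<in> carrier A"
    using sgs x cl by (intro A_coeff.tail_coboundary_closed) auto
  have step: "\<alpha>e x (\<ominus>\<^bsub>A\<^esub> f hs) = e x \<otimes>\<^bsub>A\<^esub> tail_coboundary G A f (x # hs)"
    if hs: "hs \<in> tuples G n" for hs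
  proof -
    have fh: "f hs \<in> carrier A"
      using fA hs by blast
    have "\<alpha>e x (\<ominus>\<^bsub>A\<^esub> f hs) \<oplus>\<^bsub>A\<^esub> \<alpha>e x (f hs) = \<zero>\<^bsub>A\<^esub>"
    proof -
      have "\<alpha>e x \<zero>\<^bsub>A\<^esub> \<oplus>\<^bsub>A\<^esub> \<alpha>e x \<zero>\<^bsub>A\<^esub> = \<alpha>e x \<zero>\<^bsub>A\<^esub>"
        using \<alpha>e_add[OF x, of "\<zero>\<^bsub>A\<^esub>" "\<zero>\<^bsub>A\<^esub>"] by simp
      then have "\<alpha>e x \<zero>\<^bsub>A\<^esub> = \<zero>\<^bsub>A\<^esub>"
        using \<alpha>e_closed[OF x, of "\<zero>\<^bsub>A\<^esub>"] by (metis M.add.r_cancel_one M.zero_closed)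
      then show ?thesis
        using \<alpha>e_add[OF x, of "\<ominus>\<^bsub>A\<^esub> f hs" "f hs"] fh by (simp add: M.l_neg)
    qed
    moreover have "e x \<otimes>\<^bsub>A\<^esub> tail_coboundary G A f (x # hs) \<oplus>\<^bsub>A\<^esub> \<alpha>e x (f hs) = \<zero>\<^bsub>A\<^esub>"
      using f hs x fh cl by (simp add: truncated_cocycle_def M.a_comm \<alpha>e_closed e_closed)
    \<comment> \<open>Both sides of the claim are additive inverses of
      \<open>\<alpha>e x (f hs)\<close>.\<close>
    ultimately have "\<ominus>\<^bsub>A\<^esub> \<alpha>e x (f hs) = \<alpha>e x (\<ominus>\<^bsub>A\<^esub> f hs)"
      "\<ominus>\<^bsub>A\<^esub> \<alpha>e x (f hs) = e x \<otimes>\<^bsub>A\<^esub> tail_coboundary G A f (x # hs)"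
      using x hs fh cl by (auto intro!: M.minus_equality \<alpha>e_closed e_closed)
    then show ?thesis
      by simp
  qed
  have "\<alpha>e x (\<ominus>\<^bsub>A\<^esub> tail_coboundary G A f (s # gs))
      = \<alpha>e x (tail_coboundary G A (\<lambda>hs. \<ominus>\<^bsub>A\<^esub> f hs) (s # gs))"
    using minus_tail_coboundary[OF sgs fA] by simp
  also have "\<dots> = tail_coboundary G A (\<lambda>hs. \<alpha>e x (\<ominus>\<^bsub>A\<^esub> f hs)) (s # gs)"
    using sgs fA x
    by (intro tail_coboundary_hom[where n = n and h = "\<alpha>e x"]
        \<alpha>e_hom A_coeff.group_coefficients_axioms) auto
  also have "\<dots> = tail_coboundary G A (\<lambda>hs. e x \<otimes>\<^bsub>A\<^esub> tail_coboundary G A f (x # hs)) (s # gs)"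
    by (intro A_coeff.tail_coboundary_cong[OF sgs] step)
  also have "\<dots> = e x \<otimes>\<^bsub>A\<^esub> ?T"
    using x sgs cl by (intro left_mult_tail_coboundary[where n = n, symmetric] e_closed) auto
  also have "?T = \<ominus>\<^bsub>A\<^esub> tail_coboundary G A f (x \<otimes>\<^bsub>G\<^esub> s # gs)"
    using A_coeff.tail_coboundary_square[OF x s gs fA] T cl[of "x \<otimes>\<^bsub>G\<^esub> s" gs] x s gs
    by (intro M.minus_equality[symmetric]) (auto simp: M.a_comm)
  finally show "\<alpha>e x (\<ominus>\<^bsub>A\<^esub> tail_coboundary G A f (s # gs))
      = e x \<otimes>\<^bsub>A\<^esub> (\<ominus>\<^bsub>A\<^esub> tail_coboundary G A f (x \<otimes>\<^bsub>G\<^esub> s # gs))" .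
qed

text \<open>The vanishing of \<open>\<partial>\<partial>f\<close>, in the form needed for the tail
  of the cocycle identity of \<open>globalization\<close> on components.\<close>

lemma tail_coboundary_minus_tail_coboundary:
  assumes "f \<in> tuples G n \<rightarrow> carrier A" "g \<in> carrier G" "gs \<in> tuples G n" "t \<in> carrier G"
  shows "tail_coboundary G A (\<lambda>hs. \<ominus>\<^bsub>A\<^esub> tail_coboundary G A f (t # hs)) (g # gs)
    = tail_coboundary G A f (t \<otimes>\<^bsub>G\<^esub> g # gs)"
proof -
  have cl: "tail_coboundary G A f (s # hs) \<in> carrier A"
    if "s \<in> carrier G" "hs \<in> tuples G n" for s hs
    using that assms(1) by (intro A_coeff.tail_coboundary_closed) auto
  let ?T = "tail_coboundary G A (\<lambda>hs. tail_coboundary G A f (t # hs)) (g # gs)"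
  have T: "?T \<in> carrier A"
    using assms cl by (intro A_coeff.tail_coboundary_closed[where n = n]) auto
  have "tail_coboundary G A (\<lambda>hs. \<ominus>\<^bsub>A\<^esub> tail_coboundary G A f (t # hs)) (g # gs) = \<ominus>\<^bsub>A\<^esub> ?T"
    using assms cl by (intro minus_tail_coboundary[where n = n, symmetric]) auto
  also have "\<dots> = tail_coboundary G A f (t \<otimes>\<^bsub>G\<^esub> g # gs)"
    using A_coeff.tail_coboundary_square[OF assms(4,2,3,1)] T assms cl
    by (intro M.minus_equality) auto
  finally show ?thesis .
qed

text \<open>The first entry of the coboundary becomes the component index and the other entries the
  argument, so an \<open>n\<close>-cochain results again.\<close>

definition globalization :: "('g list \<Rightarrow> 'a) \<Rightarrow> 'g list \<Rightarrow> ('b \<Rightarrow> 'b) \<times> ('b \<Rightarrow> 'b)"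
  where "globalization f gs = multiplier_of (\<lambda>t. \<ominus>\<^bsub>A\<^esub> tail_coboundary G A f (t # gs))"

lemma globalization_closed:
  assumes "truncated_cocycle n f"
  shows "globalization f \<in> tuples G n \<rightarrow> carrier (multiplier_algebra K B)"
  using assms
  by (auto simp: globalization_def intro!: multiplier_of_closed compatible_tail_coboundary)

text \<open>The truncated identity with neutral first entry says that the family defining the
  multiplier has the value \<open>f gs\<close> at the neutral element.\<close>

lemma globalization_\<phi>:
  assumes f: "truncated_cocycle n f" and gs: "gs \<in> tuples G n" and a: "a \<in> carrier A"
  shows "fst (globalization f gs) (\<phi> a) = \<phi> (a \<otimes>\<^bsub>A\<^esub> f gs)"
proof -
  have fA: "f \<in> tuples G n \<rightarrow> carrier A"
    using f by (simp add: truncated_cocycle_def)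
  then have fgs: "f gs \<in> carrier A"
    using gs by blast
  have T: "tail_coboundary G A f (\<one>\<^bsub>G\<^esub> # gs) \<in> carrier A"
    using fA gs by (intro A_coeff.tail_coboundary_closed) auto
  have "\<alpha>e \<one>\<^bsub>G\<^esub> (f gs) \<oplus>\<^bsub>A\<^esub> e \<one>\<^bsub>G\<^esub> \<otimes>\<^bsub>A\<^esub> tail_coboundary G A f (\<one>\<^bsub>G\<^esub> # gs) = \<zero>\<^bsub>A\<^esub>"
    using f gs unfolding truncated_cocycle_def by blast
  then have "f gs \<oplus>\<^bsub>A\<^esub> tail_coboundary G A f (\<one>\<^bsub>G\<^esub> # gs) = \<zero>\<^bsub>A\<^esub>"
    using fgs T by (simp add: e_one \<alpha>_one)
  then have "\<ominus>\<^bsub>A\<^esub> tail_coboundary G A f (\<one>\<^bsub>G\<^esub> # gs) = f gs"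
    using fgs T by (intro M.minus_equality)
  then show ?thesis
    using multiplier_of_\<phi>[OF compatible_tail_coboundary[OF f gs] a]
    by (simp add: globalization_def)
qed

lemma component_globalization:
  assumes f: "truncated_cocycle n f" and gs: "gs \<in> tuples G n"
    and b: "b \<in> carrier B" and t: "t \<in> carrier G"
  shows "component (fst (globalization f gs) b) t
      = component b t \<otimes>\<^bsub>A\<^esub> (\<ominus>\<^bsub>A\<^esub> tail_coboundary G A f (t # gs))"
    and "component (snd (globalization f gs) b) t
      = (\<ominus>\<^bsub>A\<^esub> tail_coboundary G A f (t # gs)) \<otimes>\<^bsub>A\<^esub> component b t"
  using component_fst_multiplier_of[OF compatible_tail_coboundary[OF f gs] b t]
    component_snd_multiplier_of[OF compatible_tail_coboundary[OF f gs] b t]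
  by (simp_all add: globalization_def)

text \<open>On components, the action shifts the index of the family from \<open>t\<close> to
  \<open>t \<otimes> g\<close>. The tail contributes the opposite of that shifted value, by
  \<open>tail_coboundary_minus_tail_coboundary\<close>.\<close>

lemma globalization_cocycle:
  assumes f: "truncated_cocycle n f"
  shows "globalization f \<in> cocycles G (multiplier_algebra K B) (multiplier_action G B \<beta>) n"
proof -
  let ?M = "multiplier_algebra K B" and ?u = "globalization f"
  have uM: "?u \<in> tuples G n \<rightarrow> carrier ?M"
    using f by (rule globalization_closed)
  have fA: "f \<in> tuples G n \<rightarrow> carrier A"
    using f by (simp add: truncated_cocycle_def)
  have "coboundary G ?M (multiplier_action G B \<beta>) n ?u gs = \<zero>\<^bsub>?M\<^esub>"
    if "gs \<in> tuples G (Suc n)" for gs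
  proof -
    from that obtain g hs where gs: "gs = g # hs" and g: "g \<in> carrier G" and hs: "hs \<in> tuples G n"
      by (rule tuples_SucE)
    have ghs: "g # hs \<in> tuples G (Suc n)"
      using g hs by simp
    have cl: "tail_coboundary G A f (s # ks) \<in> carrier A"
      if "s \<in> carrier G" "ks \<in> tuples G n" for s ks
      using that fA by (intro A_coeff.tail_coboundary_closed) auto
    let ?act = "multiplier_action G B \<beta> g (?u hs)" and ?tail = "tail_coboundary G ?M ?u (g # hs)"
    have act: "?act \<in> carrier ?M"
      using uM g hs by (intro glob.multiplier_action_closed) auto
    have tail: "?tail \<in> carrier ?M"
      using ghs uM by (rule M_coeff.tail_coboundary_closed)
    have "?act \<oplus>\<^bsub>?M\<^esub> ?tail = \<zero>\<^bsub>?M\<^esub>"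
    proof (rule glob.multiplier_eqI)
      fix b assume b: "b \<in> carrier B"
      let ?b = "\<beta> (inv\<^bsub>G\<^esub> g) b"
      have b': "?b \<in> carrier B"
        using b g by (simp add: glob.\<beta>_closed)
      have u_closed: "fst (?u hs) ?b \<in> carrier B" "snd (?u hs) ?b \<in> carrier B"
        using uM hs b'
        by (blast intro: glob.multiplier_fst_closed glob.multiplier_snd_closed)+
      \<comment> \<open>The shifted index undoes the inverse translation of the argument.\<close>
      have cb: "component ?b (t \<otimes>\<^bsub>G\<^esub> g) = component b t" if "t \<in> carrier G" for t
        using that g b by (simp add: component_\<beta> G.m_assoc)
      have "component (fst ?act b) t \<oplus>\<^bsub>A\<^esub> component (fst ?tail b) t = \<zero>\<^bsub>A\<^esub>"
        if t: "t \<in> carrier G" for t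
      proof -
        have comp: "component b t \<in> carrier A"
          using b t by (rule component_closed)
        have Tc: "tail_coboundary G A f (t \<otimes>\<^bsub>G\<^esub> g # hs) \<in> carrier A"
          using t g hs by (intro cl) auto
        \<comment> \<open>Evaluation at \<open>b\<close> followed by the component at
          \<open>t\<close> is additive on multipliers, so it passes through the coboundary.\<close>
        have "component (fst ?tail b) t
            = tail_coboundary G A (\<lambda>ks. component (fst (?u ks) b) t) (g # hs)"
          using b ghs uM t hom_compose[OF glob.multiplier_fst_hom[OF b] component_hom[OF t]]
          by (intro tail_coboundary_hom[where n = n and h = "\<lambda>\<gamma>. component (fst \<gamma> b) t"]
              M_coeff.group_coefficients_axioms A_coeff.group_coefficients_axioms)
            (simp_all add: o_def)
        also have "\<dots> = tail_coboundary G A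
            (\<lambda>ks. component b t \<otimes>\<^bsub>A\<^esub> (\<ominus>\<^bsub>A\<^esub> tail_coboundary G A f (t # ks))) (g # hs)"
          by (intro A_coeff.tail_coboundary_cong[OF ghs] component_globalization[OF f _ b t])
        also have "\<dots> = component b t \<otimes>\<^bsub>A\<^esub>
            tail_coboundary G A (\<lambda>ks. \<ominus>\<^bsub>A\<^esub> tail_coboundary G A f (t # ks)) (g # hs)"
          using comp ghs cl t by (intro left_mult_tail_coboundary[where n = n, symmetric]) auto
        also have "\<dots> = component b t \<otimes>\<^bsub>A\<^esub> tail_coboundary G A f (t \<otimes>\<^bsub>G\<^esub> g # hs)"
          using tail_coboundary_minus_tail_coboundary[OF fA g hs t] by simp
        finally have "component (fst ?tail b) t
            = component b t \<otimes>\<^bsub>A\<^esub> tail_coboundary G A f (t \<otimes>\<^bsub>G\<^esub> g # hs)" .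
        moreover have "component (fst ?act b) t
            = component b t \<otimes>\<^bsub>A\<^esub> (\<ominus>\<^bsub>A\<^esub> tail_coboundary G A f (t \<otimes>\<^bsub>G\<^esub> g # hs))"
          using b b' g hs t component_\<beta>[OF u_closed(1) g t]
          by (simp add: multiplier_action_def split_beta component_globalization[OF f] cb)
        ultimately show ?thesis
          using comp Tc by (simp add: M.l_neg r_minus)
      qed
      then show "fst (?act \<oplus>\<^bsub>?M\<^esub> ?tail) b = fst \<zero>\<^bsub>?M\<^esub> b"
        using b act tail
        by (intro component_inject)
          (simp_all add: glob.multiplier_add glob.multiplier_zero component_add component_zero
            glob.multiplier_fst_closed)
      \<comment> \<open>The second half is dual: the family multiplies from the left, and the
        component of \<open>b\<close> is factored out on the right.\<close>
      have "component (snd ?act b) t \<oplus>\<^bsub>A\<^esub> component (snd ?tail b) t = \<zero>\<^bsub>A\<^esub>"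
        if t: "t \<in> carrier G" for t
      proof -
        have comp: "component b t \<in> carrier A"
          using b t by (rule component_closed)
        have Tc: "tail_coboundary G A f (t \<otimes>\<^bsub>G\<^esub> g # hs) \<in> carrier A"
          using t g hs by (intro cl) auto
        have "component (snd ?tail b) t
            = tail_coboundary G A (\<lambda>ks. component (snd (?u ks) b) t) (g # hs)"
          using b ghs uM t hom_compose[OF glob.multiplier_snd_hom[OF b] component_hom[OF t]]
          by (intro tail_coboundary_hom[where n = n and h = "\<lambda>\<gamma>. component (snd \<gamma> b) t"]
              M_coeff.group_coefficients_axioms A_coeff.group_coefficients_axioms)
            (simp_all add: o_def)
        also have "\<dots> = tail_coboundary G A
            (\<lambda>ks. (\<ominus>\<^bsub>A\<^esub> tail_coboundary G A f (t # ks)) \<otimes>\<^bsub>A\<^esub> component b t) (g # hs)"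
          by (intro A_coeff.tail_coboundary_cong[OF ghs] component_globalization[OF f _ b t])
        also have "\<dots> =
            tail_coboundary G A (\<lambda>ks. \<ominus>\<^bsub>A\<^esub> tail_coboundary G A f (t # ks)) (g # hs)
            \<otimes>\<^bsub>A\<^esub> component b t"
          using comp ghs cl t by (intro right_mult_tail_coboundary[where n = n, symmetric]) auto
        also have "\<dots> = tail_coboundary G A f (t \<otimes>\<^bsub>G\<^esub> g # hs) \<otimes>\<^bsub>A\<^esub> component b t"
          using tail_coboundary_minus_tail_coboundary[OF fA g hs t] by simp
        finally have "component (snd ?tail b) t
            = tail_coboundary G A f (t \<otimes>\<^bsub>G\<^esub> g # hs) \<otimes>\<^bsub>A\<^esub> component b t" .
        moreover have "component (snd ?act b) t
            = (\<ominus>\<^bsub>A\<^esub> tail_coboundary G A f (t \<otimes>\<^bsub>G\<^esub> g # hs)) \<otimes>\<^bsub>A\<^esub> component b t"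
          using b b' g hs t component_\<beta>[OF u_closed(2) g t]
          by (simp add: multiplier_action_def split_beta component_globalization[OF f] cb)
        ultimately show ?thesis
          using comp Tc by (simp add: M.l_neg l_minus)
      qed
      then show "snd (?act \<oplus>\<^bsub>?M\<^esub> ?tail) b = snd \<zero>\<^bsub>?M\<^esub> b"
        using b act tail
        by (intro component_inject)
          (simp_all add: glob.multiplier_add glob.multiplier_zero component_add component_zero
            glob.multiplier_snd_closed)
    qed (use act tail in simp_all)
    then show ?thesis
      using glob.coboundary_eq_tail[OF uM ghs] by (simp add: gs)
  qed
  with uM show ?thesis
    by (simp add: cocycles_def)
qed

text \<open>The relation to \<open>w\<close> needs no cocycle condition: on the image of
  \<open>\<phi>\<close> the first half of a globalizing multiplier is right multiplication by
  \<open>f gs\<close>, in both directions of the proof, and it is read off at the tuple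
  unit.\<close>

lemma globalizable_iff:
  assumes w: "w \<in> par_cochains A G e n"
  shows "globalizable K A G e B \<beta> \<phi> n w \<longleftrightarrow>
    (\<exists>f. truncated_cocycle n f \<and> (\<forall>gs\<in>tuples G n. w gs = tuple_unit A G e gs \<otimes>\<^bsub>A\<^esub> f gs))"
proof
  assume "globalizable K A G e B \<beta> \<phi> n w"
  then obtain u where u: "u \<in> cocycles G (multiplier_algebra K B) (multiplier_action G B \<beta>) n"
    and wu: "\<And>gs. gs \<in> tuples G n \<Longrightarrow> \<phi> (w gs) = fst (u gs) (\<phi> (tuple_unit A G e gs))"
    by (auto simp: globalizable_def mult_right_def)
  have u_left: "fst (u gs) \<in> left_module_endos K B" if "gs \<in> tuples G n" for gs
    using u that by (auto simp: cocycles_def glob.multiplier_carrier_iff)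
  have u_mult: "fst (u gs) (\<phi> a) = \<phi> a \<otimes>\<^bsub>B\<^esub> fst (u gs) (\<phi> \<one>\<^bsub>A\<^esub>)"
    if "gs \<in> tuples G n" "a \<in> carrier A" for gs a
  proof -
    have "fst (u gs) (\<phi> a \<otimes>\<^bsub>B\<^esub> \<phi> \<one>\<^bsub>A\<^esub>) = \<phi> a \<otimes>\<^bsub>B\<^esub> fst (u gs) (\<phi> \<one>\<^bsub>A\<^esub>)"
      using u_left[OF that(1)] that(2) \<phi>_closed by (simp add: left_module_endos_def)
    then show ?thesis
      using that by (simp flip: \<phi>_mult)
  qed
  define f where "f gs = inv_into (carrier A) \<phi> (fst (u gs) (\<phi> \<one>\<^bsub>A\<^esub>))" for gs
  \<comment> \<open>Since \<open>\<phi> \<one>\<close> is idempotent, the left module law makes this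
    value a multiple of \<open>\<phi> \<one>\<close>, hence an element of the ideal.\<close>
  have image: "fst (u gs) (\<phi> \<one>\<^bsub>A\<^esub>) \<in> \<phi> ` carrier A" if gs: "gs \<in> tuples G n" for gs
  proof -
    have "fst (u gs) (\<phi> \<one>\<^bsub>A\<^esub>) \<in> carrier B"
      using u_left[OF gs] \<phi>_closed[of "\<one>\<^bsub>A\<^esub>"] by (auto simp: left_module_endos_def)
    then show ?thesis
      using \<phi>_ideal_right[of "fst (u gs) (\<phi> \<one>\<^bsub>A\<^esub>)" "\<one>\<^bsub>A\<^esub>"] u_mult[OF gs, of "\<one>\<^bsub>A\<^esub>"] by simp
  qed
  have f: "f \<in> tuples G n \<rightarrow> carrier A"
    unfolding f_def using image by (auto intro!: inv_into_into)
  have uf: "\<phi> (f gs) = fst (u gs) (\<phi> \<one>\<^bsub>A\<^esub>)" if "gs \<in> tuples G n" for gs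
    unfolding f_def using image[OF that] by (rule f_inv_into_f)
  have "w gs = tuple_unit A G e gs \<otimes>\<^bsub>A\<^esub> f gs" if gs: "gs \<in> tuples G n" for gs
  proof -
    have tu: "tuple_unit A G e gs \<in> carrier A"
      using gs by (rule tuple_unit_closed)
    have fgs: "f gs \<in> carrier A"
      using f gs by blast
    have "\<phi> (w gs) = \<phi> (tuple_unit A G e gs \<otimes>\<^bsub>A\<^esub> f gs)"
      using wu[OF gs] u_mult[OF gs tu] tu fgs by (simp add: \<phi>_mult uf[OF gs])
    \<comment> \<open>The cochain condition places \<open>w gs\<close> in \<open>A\<close>, which
      the injectivity of \<open>\<phi>\<close> presupposes.\<close>
    moreover have "w gs \<in> carrier A"
      using w gs tu by (auto simp: par_cochains_def)
    ultimately show ?thesis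
      using tu fgs by (simp add: \<phi>_eq_iff)
  qed
  with truncated_cocycle_of_multiplier_cocycle[OF u f uf]
  show "\<exists>f. truncated_cocycle n f \<and>
      (\<forall>gs\<in>tuples G n. w gs = tuple_unit A G e gs \<otimes>\<^bsub>A\<^esub> f gs)"
    by blast
next
  assume "\<exists>f. truncated_cocycle n f \<and>
      (\<forall>gs\<in>tuples G n. w gs = tuple_unit A G e gs \<otimes>\<^bsub>A\<^esub> f gs)"
  then obtain f where f: "truncated_cocycle n f"
    and wf: "\<And>gs. gs \<in> tuples G n \<Longrightarrow> w gs = tuple_unit A G e gs \<otimes>\<^bsub>A\<^esub> f gs"
    by blast
  then show "globalizable K A G e B \<beta> \<phi> n w"
    unfolding globalizable_def mult_right_def
    by (intro bexI[OF _ globalization_cocycle[OF f]])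
      (simp add: globalization_\<phi>[OF f] tuple_unit_closed)
qed

end

theorem theorem3p6:
  fixes K :: "('k, 'r) ring_scheme" and A :: "('k, 'a, 's) module_scheme"
    and G :: "('g, 'm) monoid_scheme" and D :: "'g \<Rightarrow> 'a set" and \<alpha> :: "'g \<Rightarrow> 'a \<Rightarrow> 'a"
    and e :: "'g \<Rightarrow> 'a" and B :: "('k, 'b, 't) module_scheme" and \<beta> :: "'g \<Rightarrow> 'b \<Rightarrow> 'b"
    and \<phi> :: "'a \<Rightarrow> 'b" and n :: nat and w :: "'g list \<Rightarrow> 'a"
  assumes "unital_partial_action K A G D \<alpha> e"
    and "enveloping_action K A G D \<alpha> B \<beta> \<phi>"
    and "n \<ge> 1"
    and "w \<in> par_cocycles A G \<alpha> e n"
  shows "globalizable K A G e B \<beta> \<phi> n w \<longleftrightarrow>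
    (\<exists>w' \<in> tuples G n \<rightarrow> carrier A.
      (\<forall>gs\<in>tuples G (n + 1).
        \<alpha> (hd gs) (e (inv\<^bsub>G\<^esub> (hd gs)) \<otimes>\<^bsub>A\<^esub> w' (tl gs))
        \<oplus>\<^bsub>A\<^esub> (\<Oplus>\<^bsub>A\<^esub>i\<in>{1..n}. [((-1::int) ^ i)] \<cdot>\<^bsub>A\<^esub> (e (hd gs) \<otimes>\<^bsub>A\<^esub> w' (merge G i gs)))
        \<oplus>\<^bsub>A\<^esub> [((-1::int) ^ (n + 1))] \<cdot>\<^bsub>A\<^esub> (e (hd gs) \<otimes>\<^bsub>A\<^esub> w' (butlast gs)) = \<zero>\<^bsub>A\<^esub>) \<and>
      (\<forall>gs\<in>tuples G n. w gs = tuple_unit A G e gs \<otimes>\<^bsub>A\<^esub> w' gs))"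
proof -
  interpret unital_enveloping_action K A G D \<alpha> e B \<beta> \<phi>
    by (intro unital_enveloping_action.intro assms(1,2))
  have "w \<in> par_cochains A G e n"
    using assms(4) by (simp add: par_cocycles_def)
  then have "globalizable K A G e B \<beta> \<phi> n w \<longleftrightarrow>
      (\<exists>f. truncated_cocycle n f \<and> (\<forall>gs\<in>tuples G n. w gs = tuple_unit A G e gs \<otimes>\<^bsub>A\<^esub> f gs))"
    by (rule globalizable_iff)
  \<comment> \<open>Membership in the function space is part of \<open>truncated_cocycle\<close>; as
    bound of the quantifier it provides the assumption of
    \<open>truncated_cocycle_iff\<close>.\<close>
  also have "\<dots> \<longleftrightarrow> (\<exists>f \<in> tuples G n \<rightarrow> carrier A. truncated_cocycle n f \<and>
      (\<forall>gs\<in>tuples G n. w gs = tuple_unit A G e gs \<otimes>\<^bsub>A\<^esub> f gs))"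
    by (auto simp: truncated_cocycle_def)
  finally show ?thesis
    by (simp only: truncated_cocycle_iff cong: bex_cong)
qed

end
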